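(* There exists an absolute constant $K$ such that the following holds for every finite poset $P$. Suppose there exist a constant $C_P$ and a positive integer $d$ such that $\mathrm{ex}^*(n,d,P)\leq C_P n^{d-1}$ for all positive integers $n$. Then for every positive integer $t\ge 1$ there exists a constant $c_{t,d}>0$ (depending only on $t$ and $d$) such that for every $\varepsilon>0$ the following holds: if $n$ is sufficiently large and $\mathcal F\subseteq 2^{[n]}$ satisfies $$|\mathcal F|\geq \left(t+K\sqrt d\,C_P+\varepsilon\right)\binom{n}{\lfloor n/2\rfloor},$$ then the number of induced copies of $P$ contained in $\mathcal F$ is at least $$c_{t,d}\,\varepsilon\, n^{\left\lfloor \frac{t}{K\sqrt d}\right\rfloor}\binom{n}{\lfloor n/2\rfloor}.$$
   Context: $[n]=\{1,\dots,n\}$, and $2^{[n]}$ is the power set of $[n]$ partially ordered by inclusion. $[n]^d$ carries the coordinatewise order: $(a_1,\dots,a_d)\preceq(b_1,\dots,b_d)$ if $a_i\le b_i$ for all $i$. An induced copy of a finite poset $P$ in a poset $Q$ is the image of an injective map $f:P\to Q$ such that $f(x)<_Q f(y)$ if and only if $x<_P y$; a subset of $Q$ is induced $P$-free if it contains no induced copy of $P$. $\mathrm{ex}^*(n,d,P)$ is the maximum size of a subset of $[n]^d$ that is induced $P$-free.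
   Formalization: The poset P is assumed to have at least two elements: for |P|=1 the claim is false (ex*=0, C_P=0, and the number of copies is just |F|), and for empty P ex* is undefined; finite posets are represented on sets of natural numbers, which covers all up to isomorphism. *)

theory Defs
  imports Complex_Main "HOL-Library.FuncSet"
begin

text \<open>
  A finite poset is given by a carrier set and a reflexive order relation on it, as in
  \<^const>\<open>partial_order_on\<close>; the strict order of \<open>r\<close> is then \<open>r - Id\<close>.
  A copy is the image of an embedding, so embeddings that differ by an automorphism of the
  embedded poset give the same copy.
\<close>

definition induced_copies :: "'a set \<Rightarrow> 'a rel \<Rightarrow> 'b set \<Rightarrow> 'b rel \<Rightarrow> 'b set set" where
  "induced_copies P r Q s =
     {f ` P | f. f \<in> P \<rightarrow> Q \<and> inj_on f P \<and>
        (\<forall>x\<in>P. \<forall>y\<in>P. (f x, f y) \<in> s - Id \<longleftrightarrow> (x, y) \<in> r - Id)}"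

definition induced_copies_in :: "'a set \<Rightarrow> 'a rel \<Rightarrow> 'b set \<Rightarrow> 'b rel \<Rightarrow> 'b set \<Rightarrow> 'b set set" where
  "induced_copies_in P r Q s F = {X \<in> induced_copies P r Q s. X \<subseteq> F}"

definition induced_free :: "'a set \<Rightarrow> 'a rel \<Rightarrow> 'b set \<Rightarrow> 'b rel \<Rightarrow> 'b set \<Rightarrow> bool" where
  "induced_free P r Q s F \<longleftrightarrow> induced_copies_in P r Q s F = {}"

definition grid :: "nat \<Rightarrow> nat \<Rightarrow> (nat \<Rightarrow> nat) set" where
  "grid n d = {1..d} \<rightarrow>\<^sub>E {1..n}"

definition grid_order :: "nat \<Rightarrow> nat \<Rightarrow> (nat \<Rightarrow> nat) rel" where
  "grid_order n d = relation_of (\<lambda>a b. \<forall>i\<in>{1..d}. a i \<le> b i) (grid n d)"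

definition cube_order :: "nat \<Rightarrow> nat set rel" where
  "cube_order n = relation_of (\<subseteq>) (Pow {1..n})"

text \<open>
  For nonempty \<open>P\<close> the empty set is induced \<open>P\<close>-free, so this is the maximum of a
  finite nonempty set. For empty \<open>P\<close> nothing is \<open>P\<close>-free and the value is unspecified.
\<close>

definition ex_star :: "nat \<Rightarrow> nat \<Rightarrow> 'a set \<Rightarrow> 'a rel \<Rightarrow> nat" where
  "ex_star n d P r =
     Max {card S | S. S \<subseteq> grid n d \<and> induced_free P r (grid n d) (grid_order n d) S}"

text \<open>
  Copies depend only on the isomorphism type of the embedded poset, and every finite poset is
  isomorphic to one whose carrier is a set of natural numbers. Quantifying over finite posets on
  sets of naturals is therefore quantifying over all finite posets, which cannot otherwise be
  done below an existential quantifier, since there is no quantification over types.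
\<close>

lemma finite_poset_on_nat:
  fixes P :: "'a set" and r :: "'a rel"
  assumes fin: "finite P" and po: "partial_order_on P r"
  obtains P' :: "nat set" and r' :: "nat rel" where
    "finite P'" "card P' = card P" "partial_order_on P' r'"
    "\<And>(Q :: 'b set) s. induced_copies P' r' Q s = induced_copies P r Q s"
    "\<And>n d. ex_star n d P' r' = ex_star n d P r"
proof -
  obtain g :: "'a \<Rightarrow> nat" where g: "inj_on g P"
    using fin finite_imp_inj_to_nat_seg by blast
  define P' where "P' = g ` P"
  define r' where "r' = {(g x, g y) | x y. x \<in> P \<and> y \<in> P \<and> (x, y) \<in> r}"
  define h where "h = inv_into P g"
  have hg: "h (g x) = x" if "x \<in> P" for x
    using that g by (simp add: h_def)
  have r'_iff: "(g x, g y) \<in> r' \<longleftrightarrow> (x, y) \<in> r" if "x \<in> P" "y \<in> P" for x y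
    using that g by (auto simp: r'_def inj_on_eq_iff)
  have g_iff: "g x = g y \<longleftrightarrow> x = y" if "x \<in> P" "y \<in> P" for x y
    using that g by (simp add: inj_on_eq_iff)
  have copies: "induced_copies P' r' Q s = induced_copies P r Q s"
    for Q :: "'c set" and s
  proof (intro equalityI subsetI)
    fix X assume "X \<in> induced_copies P' r' Q s"
    then obtain f where f: "X = f ` P'" "f \<in> P' \<rightarrow> Q" "inj_on f P'"
      "\<forall>x\<in>P'. \<forall>y\<in>P'. (f x, f y) \<in> s - Id \<longleftrightarrow> (x, y) \<in> r' - Id"
      by (auto simp: induced_copies_def)
    have "X = (f \<circ> g) ` P" "f \<circ> g \<in> P \<rightarrow> Q" "inj_on (f \<circ> g) P"
      using f g by (auto simp: P'_def comp_inj_on image_comp)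
    moreover have "\<forall>x\<in>P. \<forall>y\<in>P. ((f \<circ> g) x, (f \<circ> g) y) \<in> s - Id \<longleftrightarrow> (x, y) \<in> r - Id"
      using f(4) by (simp add: P'_def r'_iff g_iff)
    ultimately show "X \<in> induced_copies P r Q s"
      unfolding induced_copies_def by blast
  next
    fix X assume "X \<in> induced_copies P r Q s"
    then obtain f where f: "X = f ` P" "f \<in> P \<rightarrow> Q" "inj_on f P"
      "\<forall>x\<in>P. \<forall>y\<in>P. (f x, f y) \<in> s - Id \<longleftrightarrow> (x, y) \<in> r - Id"
      by (auto simp: induced_copies_def)
    have "X = (f \<circ> h) ` P'" "f \<circ> h \<in> P' \<rightarrow> Q"
      using f(1,2) by (auto simp: P'_def hg image_image)
    moreover have "inj_on (f \<circ> h) P'"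
      using f(3) by (auto simp: inj_on_def P'_def hg)
    moreover have "\<forall>x\<in>P'. \<forall>y\<in>P'. ((f \<circ> h) x, (f \<circ> h) y) \<in> s - Id \<longleftrightarrow> (x, y) \<in> r' - Id"
      using f(4) by (simp add: P'_def hg r'_iff g_iff)
    ultimately show "X \<in> induced_copies P' r' Q s"
      unfolding induced_copies_def by blast
  qed
  have "refl_on P' r'" "r' \<subseteq> P' \<times> P'"
    using po by (auto simp: partial_order_on_def preorder_on_def refl_on_def P'_def r'_def)
  moreover have "trans r'"
  proof (rule transI)
    fix u v w assume "(u, v) \<in> r'" "(v, w) \<in> r'"
    then obtain x y y' z where xyz: "u = g x" "v = g y" "v = g y'" "w = g z" "(x, y) \<in> r" "(y', z) \<in> r"
      "x \<in> P" "y \<in> P" "y' \<in> P" "z \<in> P"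
      unfolding r'_def by blast
    then have "y = y'" using g_iff by metis
    then have "(x, z) \<in> r"
      using xyz po unfolding partial_order_on_def preorder_on_def by (meson transD)
    then show "(u, w) \<in> r'" using xyz r'_iff by simp
  qed
  moreover have "antisym r'"
  proof (rule antisymI)
    fix u v assume uv: "(u, v) \<in> r'" "(v, u) \<in> r'"
    then obtain x y where xy: "u = g x" "v = g y" "x \<in> P" "y \<in> P"
      unfolding r'_def by blast
    then have "(x, y) \<in> r" "(y, x) \<in> r" using uv r'_iff by simp_all
    then have "x = y"
      using po unfolding partial_order_on_def by (meson antisymD)
    then show "u = v" using xy by simp
  qed
  ultimately have "partial_order_on P' r'"
    by (simp add: partial_order_on_def preorder_on_def)
  moreover have "ex_star n d P' r' = ex_star n d P r" for n d
    by (simp add: ex_star_def induced_free_def induced_copies_in_def copies)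
  moreover have "card P' = card P" "finite P'"
    using fin g by (simp_all add: P'_def card_image)
  ultimately show thesis
    using copies that by blast
qed

end

theory Submission
  imports Defs "HOL-Combinatorics.Permutations"
begin

text \<open>
  Why the theorem holds. Split a part of \<open>{1..n}\<close> into \<open>d\<close> consecutive blocks of length
  \<open>m \<approx> n / (16 d)\<close>. A point \<open>x\<close> of the grid \<open>[m]\<^sup>d\<close> is sent to the union of
  \<open>{1..q}\<close> with the first \<open>x i\<close> elements of the \<open>i\<close>-th block, and then moved by a
  permutation \<open>p\<close>. This embeds the grid as a subposet of the cube. Choose \<open>p\<close>
  uniformly, and the offset \<open>q\<close> uniformly from a window of about \<open>\<surd>d m\<close> values that
  centres the sizes at \<open>n / 2\<close>.

  Coordinate sums in \<open>[m]\<^sup>d\<close> have standard deviation about \<open>\<surd>d m\<close>. By Chebyshev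
  the window therefore absorbs the fluctuation of the sum for most \<open>x\<close>, so every set of
  nearly central size lies in the random grid with probability at least a constant times
  \<open>m\<^bsup>d-1\<^esup> / \<surd>d\<close> over the central binomial coefficient. A family of
  \<open>t + K \<surd>d C + \<epsilon>\<close> times that coefficient hence meets the random grid in
  more than \<open>(C + s + 2) m\<^bsup>d-1\<^esup>\<close> points on average, where
  \<open>s = \<lfloor>t / (K \<surd>d)\<rfloor>\<close>; here \<open>K = 40\<close> leaves room, since \<open>C \<ge> 1\<close>.

  The surplus over \<open>C m\<^bsup>d-1\<^esup>\<close> buys stretched copies (\<open>card_le_far_tips\<close>). From each
  line in the first direction delete the points that have no other point at least
  \<open>\<sigma> = s + 2\<close> steps further along: this costs at most \<open>\<sigma>\<close> points per line. A copy of
  \<open>P\<close> in the rest has an element \<open>x\<close> that is extreme in the first direction, and moving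
  \<open>x\<close> along its line changes no order relation. So \<open>x\<close> can be pushed \<open>\<sigma>\<close> steps ahead
  of all the other elements. Up to the constants, each grid yields at least
  \<open>\<epsilon> m\<^bsup>d-1\<^esup> / \<surd>d\<close> tips of stretched copies on average.

  A stretched copy is rarely seen (\<open>far_pair_count\<close>): it contains sets \<open>A\<close> and \<open>B\<close> with
  \<open>card (A - B) = a \<ge> \<sigma>\<close>, and once \<open>A\<close> is in the grid, \<open>B\<close> is there as well only with
  probability \<open>O (n\<^bsup>-\<sigma>\<^esup>)\<close>. Double counting pairs of a grid and a tip gives at least
  about \<open>\<epsilon> n\<^bsup>\<sigma>\<^esup> / n\<close> times the central binomial coefficient many copies. The factor
  \<open>1 / n\<close> arises because sizes \<open>k\<close> are kept as long as \<open>n choose k\<close> is within a factor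
  \<open>n + 1\<close> of the central coefficient. One further factor \<open>n\<close> absorbs \<open>card P\<close> and all
  constants that depend on \<open>t\<close> and \<open>d\<close>, so that \<open>c t d = 1\<close> works; this is why
  \<open>\<sigma>\<close> exceeds \<open>s\<close> by two.
\<close>


section \<open>Stretched copies in a grid\<close>


text \<open>
  Points that can serve as the far end of a stretched copy: all other elements of the copy lie
  at least \<open>s\<close> behind in the first coordinate.
\<close>
definition far_tips :: "'a set \<Rightarrow> 'a rel \<Rightarrow> nat \<Rightarrow> nat \<Rightarrow> nat \<Rightarrow> (nat \<Rightarrow> nat) set \<Rightarrow> (nat \<Rightarrow> nat) set" where
  "far_tips P r m d s G = {x \<in> G. \<exists>X \<in> induced_copies_in P r (grid m d) (grid_order m d) G.
     x \<in> X \<and> (\<forall>y\<in>X - {x}. y 1 + s \<le> x 1)}"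

lemma finite_grid [simp]: "finite (grid m d)"
  by (auto simp: grid_def intro: finite_PiE)

lemma card_grid [simp]: "card (grid m d) = m ^ d"
  by (simp add: grid_def card_PiE)

lemma grid_orderD:
  "(x, y) \<in> grid_order m d \<longleftrightarrow> x \<in> grid m d \<and> y \<in> grid m d \<and> (\<forall>i\<in>{1..d}. x i \<le> y i)"
  by (auto simp: grid_order_def relation_of_def)

lemma card_induced_free_le_ex_star:
  assumes "P \<noteq> {}" "S \<subseteq> grid m d" "induced_free P r (grid m d) (grid_order m d) S"
  shows "card S \<le> ex_star m d P r"
proof -
  have "{card S | S. S \<subseteq> grid m d \<and> induced_free P r (grid m d) (grid_order m d) S} \<subseteq> card ` Pow (grid m d)"
    by auto
  then have "finite {card S | S. S \<subseteq> grid m d \<and> induced_free P r (grid m d) (grid_order m d) S}"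
    by (rule finite_subset) simp
  then show ?thesis unfolding ex_star_def using assms by (intro Max_ge) auto
qed

lemma eq_if_close_and_cong:
  fixes u v s :: nat
  assumes "v < u + s" "u < v + s" "u mod s = v mod s"
  shows "u = v"
proof (rule ccontr)
  assume "u \<noteq> v"
  then consider "u < v" | "v < u" by linarith
  then show False
  proof cases
    case 1
    then have "s dvd v - u" using mod_eq_dvd_iff_nat[of u v s] assms(3) by simp
    then show False using 1 assms dvd_imp_le[of s "v - u"] by linarith
  next
    case 2
    then have "s dvd u - v" using mod_eq_dvd_iff_nat[of v u s] assms(3) by simp
    then show False using 2 assms dvd_imp_le[of s "u - v"] by linarith
  qed
qed

text \<open>
  On each line in the first direction the selected points lie within distance less than \<open>s\<close> of
  one another, so their first coordinates are distinct modulo \<open>s\<close>.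
\<close>
lemma card_line_tops_le:
  assumes H: "H \<subseteq> grid m d" and d: "d \<ge> 1" and s: "s \<ge> 1"
  shows "card {x \<in> H. \<forall>z\<in>H. (\<forall>i\<in>{2..d}. z i = x i) \<longrightarrow> z 1 < x 1 + s} \<le> s * m ^ (d - 1)"
    (is "card ?R \<le> _")
proof -
  define h where "h x = (x 1 mod s, restrict x {2..d})" for x :: "nat \<Rightarrow> nat"
  have split: "{1..d} = insert 1 {2..d}" using d by auto
  have "h ` ?R \<subseteq> {..<s} \<times> ({2..d} \<rightarrow>\<^sub>E {1..m})"
  proof (intro image_subsetI)
    fix x assume "x \<in> ?R"
    then have "x \<in> {1..d} \<rightarrow>\<^sub>E {1..m}" using H by (auto simp: grid_def)
    then have "restrict x {2..d} \<in> {2..d} \<rightarrow>\<^sub>E {1..m}" unfolding split by auto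
    then show "h x \<in> {..<s} \<times> ({2..d} \<rightarrow>\<^sub>E {1..m})" using s by (simp add: h_def)
  qed
  moreover have "inj_on h ?R"
  proof (rule inj_onI)
    fix x z assume xz: "x \<in> ?R" "z \<in> ?R" "h x = h z"
    have eq: "x i = z i" if "i \<in> {2..d}" for i
      using xz(3) that by (auto simp: h_def dest: fun_cong[where x=i])
    have "z 1 < x 1 + s" "x 1 < z 1 + s" using xz(1,2) eq by auto
    moreover have "x 1 mod s = z 1 mod s" using xz by (simp add: h_def)
    ultimately have "x 1 = z 1" by (rule eq_if_close_and_cong)
    then have "x i = z i" if "i \<in> {1..d}" for i
      using that eq by (cases "i = 1") auto
    moreover have "x \<in> grid m d" "z \<in> grid m d" using xz H by auto
    ultimately show "x = z" using PiE_ext unfolding grid_def by blast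
  qed
  ultimately have "card ?R \<le> card ({..<s} \<times> ({2..d} \<rightarrow>\<^sub>E {1..m}))"
    by (intro card_inj_on_le[of h]) (auto intro: finite_PiE)
  also have "\<dots> = s * m ^ (d - 1)" by (simp add: card_cartesian_product card_PiE)
  finally show ?thesis .
qed

text \<open>
  Among the points with largest first coordinate, one with the largest coordinate sum has nothing
  above it. It can be moved along the first axis without creating or destroying a relation.
\<close>
lemma induced_copy_has_tip:
  assumes fin: "finite X" and ne: "X \<noteq> {}" and X: "X \<subseteq> grid m d" and d: "d \<ge> 1"
  obtains x where "x \<in> X" "\<And>y. y \<in> X \<Longrightarrow> y 1 \<le> x 1"
    "\<And>y. y \<in> X \<Longrightarrow> (x, y) \<in> grid_order m d \<Longrightarrow> y = x"
proof -
  define M where "M = Max ((\<lambda>x. x 1) ` X)"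
  have M: "y 1 \<le> M" if "y \<in> X" for y using fin that by (simp add: M_def)
  have "M \<in> (\<lambda>x. x 1) ` X" unfolding M_def using fin ne by (intro Max_in) auto
  then have ne': "{x \<in> X. x 1 = M} \<noteq> {}" by auto
  define f where "f x = (\<Sum>i\<in>{1..d}. x i)" for x :: "nat \<Rightarrow> nat"
  have "Max (f ` {x \<in> X. x 1 = M}) \<in> f ` {x \<in> X. x 1 = M}"
    using fin ne' by (intro Max_in) auto
  then obtain x where x: "x \<in> X" "x 1 = M" and fx: "f x = Max (f ` {x \<in> X. x 1 = M})"
    by auto
  have mx: "(\<Sum>i\<in>{1..d}. y i) \<le> (\<Sum>i\<in>{1..d}. x i)" if "y \<in> X" "y 1 = M" for y
    using fx fin that unfolding f_def[symmetric] by simp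
  show thesis
  proof (rule that[of x])
    fix y assume y: "y \<in> X" "(x, y) \<in> grid_order m d"
    have le: "\<forall>i\<in>{1..d}. x i \<le> y i" using y by (simp add: grid_orderD)
    moreover have "1 \<in> {1..d}" using d by simp
    ultimately have "x 1 \<le> y 1" by blast
    then have "y 1 = M" using M[OF y(1)] x by simp
    then have "(\<Sum>i\<in>{1..d}. y i) \<le> (\<Sum>i\<in>{1..d}. x i)" using mx y by simp
    moreover have "(\<Sum>i\<in>{1..d}. x i) \<le> (\<Sum>i\<in>{1..d}. y i)" using le by (intro sum_mono) auto
    ultimately have "(\<Sum>i\<in>{1..d}. x i) = (\<Sum>i\<in>{1..d}. y i)" by (rule antisym[rotated])
    then have "x i = y i" if "i \<in> {1..d}" for i
      using sum_mono_inv[of x "{1..d}" y i] le that by simp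
    moreover have "x \<in> grid m d" "y \<in> grid m d" using x y X by auto
    ultimately show "y = x" using PiE_ext[of y "{1..d}" _ x] unfolding grid_def by simp
  qed (use x M in auto)
qed

text \<open>
  Remove all far tips from \<open>G\<close>, and then the points that have no companion at least \<open>s\<close> ahead on
  their line. If the rest contained a copy, pushing its tip forward to such a companion would
  produce a far tip of \<open>G\<close> among points that are none. So the rest is free of \<open>P\<close>.
\<close>
lemma card_le_far_tips:
  fixes P :: "'a set"
  assumes P: "finite P" "P \<noteq> {}" and G: "G \<subseteq> grid m d" and d: "d \<ge> 1" and s: "s \<ge> 1"
  shows "card G \<le> card (far_tips P r m d s G) + ex_star m d P r + s * m ^ (d - 1)"
proof -
  have finG: "finite G" using G by (rule finite_subset) simp
  define H where "H = G - far_tips P r m d s G"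
  define H1 where "H1 = {x \<in> H. \<exists>z\<in>H. (\<forall>i\<in>{2..d}. z i = x i) \<and> x 1 + s \<le> z 1}"
  have HG: "H \<subseteq> grid m d" using G H_def by auto
  have split: "{1..d} = insert 1 {2..d}" using d by auto
  have free: "induced_free P r (grid m d) (grid_order m d) H1"
  proof (rule ccontr)
    assume "\<not> ?thesis"
    then obtain f where f: "f ` P \<subseteq> H1" "inj_on f P"
      and fo: "\<And>u v. u \<in> P \<Longrightarrow> v \<in> P \<Longrightarrow> (f u, f v) \<in> grid_order m d - Id \<longleftrightarrow> (u, v) \<in> r - Id"
      by (auto simp: induced_free_def induced_copies_in_def induced_copies_def)
    have fg: "f ` P \<subseteq> grid m d" using f HG H1_def by auto
    obtain x where x: "x \<in> f ` P" and x1: "\<And>y. y \<in> f ` P \<Longrightarrow> y 1 \<le> x 1"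
      and xm: "\<And>y. y \<in> f ` P \<Longrightarrow> (x, y) \<in> grid_order m d \<Longrightarrow> y = x"
      by (rule induced_copy_has_tip[of "f ` P" m d]) (use P fg d in auto)
    obtain p where p: "p \<in> P" "x = f p" using x by auto
    obtain z where z: "z \<in> H" "\<And>i. i \<in> {2..d} \<Longrightarrow> z i = x i" "x 1 + s \<le> z 1"
      using x f H1_def by blast
    have zg: "z \<in> grid m d" "x \<in> grid m d" using z HG x fg by auto
    define g where "g = f(p := z)"
    have below: "y 1 + s \<le> z 1" if "y \<in> f ` P" for y using x1[OF that] z by simp
    have zf: "z \<notin> f ` P" using below[of z] s by auto
    have gimg: "g ` P = insert z (f ` (P - {p}))" using p by (auto simp: g_def)
    have ginj: "inj_on g P"
      using f(2) zf by (auto simp: g_def inj_on_def)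
    have zy: "(z, y) \<notin> grid_order m d" if "y \<in> f ` P" for y
    proof -
      have "\<not> z 1 \<le> y 1" using below[OF that] s by linarith
      then show ?thesis using d unfolding grid_orderD by force
    qed
    have yz: "(y, z) \<in> grid_order m d \<longleftrightarrow> (y, x) \<in> grid_order m d" if "y \<in> f ` P" for y
    proof -
      have "y \<in> grid m d" using that fg by auto
      moreover have "y 1 \<le> z 1" "y 1 \<le> x 1" using below x1 that by fastforce+
      ultimately show ?thesis using zg z(2) unfolding grid_orderD split by auto
    qed
    have go: "(g u, g v) \<in> grid_order m d - Id \<longleftrightarrow> (u, v) \<in> r - Id" if uv: "u \<in> P" "v \<in> P" for u v
    proof -
      consider "u = p" "v = p" | "u = p" "v \<noteq> p" | "u \<noteq> p" "v = p" | "u \<noteq> p" "v \<noteq> p" by blast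
      then show ?thesis
      proof cases
        case 1 then show ?thesis by simp
      next
        \<comment> \<open>Nothing lies above the tip, neither before nor after the move.\<close>
        case 2
        then have "(g u, g v) \<notin> grid_order m d" using zy uv by (simp add: g_def)
        moreover have "(f u, f v) \<notin> grid_order m d - Id" using xm[of "f v"] 2 p uv by auto
        ultimately show ?thesis using fo uv by blast
      next
        case 3
        then have "g u \<noteq> g v" "f u \<noteq> f v" using ginj f(2) uv by (auto simp: inj_on_def)
        moreover have "(g u, g v) \<in> grid_order m d \<longleftrightarrow> (f u, f v) \<in> grid_order m d"
          using 3 yz uv p by (simp add: g_def)
        ultimately show ?thesis using fo[OF uv] by simp
      next
        case 4 then show ?thesis using fo uv by (simp add: g_def)
      qed
    qed
    have gH: "g ` P \<subseteq> H" using gimg z(1) f(1) H1_def by auto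
    have "g ` P \<in> induced_copies_in P r (grid m d) (grid_order m d) G"
    proof -
      have "g \<in> P \<rightarrow> grid m d" "g ` P \<subseteq> G" using gH HG H_def by auto
      moreover have "\<forall>u\<in>P. \<forall>v\<in>P. (g u, g v) \<in> grid_order m d - Id \<longleftrightarrow> (u, v) \<in> r - Id"
        using go by blast
      ultimately show ?thesis
        unfolding induced_copies_in_def induced_copies_def mem_Collect_eq
        using ginj by (intro conjI exI[of _ g] refl) assumption+
    qed
    moreover have "z \<in> g ` P" "\<forall>y\<in>g ` P - {z}. y 1 + s \<le> z 1"
      using gimg below by auto
    moreover have "z \<in> G" using z(1) by (simp add: H_def)
    ultimately have "z \<in> far_tips P r m d s G" unfolding far_tips_def by blast
    then show False using z(1) by (simp add: H_def)
  qed
  have "far_tips P r m d s G \<subseteq> G" by (auto simp: far_tips_def)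
  then have "card G = card (far_tips P r m d s G) + card H"
    using finG card_mono[of G "far_tips P r m d s G"]
    by (simp add: H_def card_Diff_subset finite_subset)
  moreover have "H - H1 = {x \<in> H. \<forall>z\<in>H. (\<forall>i\<in>{2..d}. z i = x i) \<longrightarrow> z 1 < x 1 + s}"
    by (auto simp: H1_def not_le)
  then have "card (H - H1) \<le> s * m ^ (d - 1)" using card_line_tops_le[OF HG d s] by simp
  moreover have "card H1 \<le> ex_star m d P r"
    using card_induced_free_le_ex_star[OF P(2) _ free] HG H1_def by auto
  moreover have "card H \<le> card H1 + card (H - H1)"
  proof -
    have "H = H1 \<union> (H - H1)" by (auto simp: H1_def)
    then show ?thesis using card_Un_le[of H1 "H - H1"] by simp
  qed
  ultimately show ?thesis by linarith
qed

text \<open>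
  The one-point grid is free of \<open>P\<close>. This makes \<open>K \<surd>d C\<close> large enough to pay for
  additive constants.
\<close>
lemma ex_star_bound_ge_1:
  assumes "finite P" "card P \<ge> 2" "\<forall>n\<ge>1. real (ex_star n d P r) \<le> C * real n ^ (d - 1)"
  shows "C \<ge> 1"
proof -
  have "induced_copies_in P r (grid 1 d) (grid_order 1 d) (grid 1 d) = {}"
  proof (rule ccontr)
    assume "\<not> ?thesis"
    then obtain f where f: "f ` P \<subseteq> grid 1 d" "inj_on f P"
      by (auto simp: induced_copies_in_def induced_copies_def)
    then have "card P \<le> card (grid 1 d)" by (meson card_inj_on_le finite_grid)
    then show False using assms(2) by simp
  qed
  then have "card (grid 1 d) \<le> ex_star 1 d P r"
    using assms(2) by (intro card_induced_free_le_ex_star) (auto simp: induced_free_def)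
  then have "real 1 \<le> real (ex_star 1 d P r)" unfolding of_nat_le_iff by simp
  then show ?thesis using assms(3)[rule_format, of 1] by simp
qed


section \<open>Grids in the Boolean lattice\<close>


text \<open>
  The \<open>d\<close> blocks fill the last \<open>d m\<close> elements of \<open>{1..n}\<close>, so that they stay clear of an initial
  segment \<open>{1..q}\<close> with \<open>q \<le> n - d m\<close>, whose length shifts the sizes of all sets of the grid.
\<close>
definition block_start :: "nat \<Rightarrow> nat \<Rightarrow> nat \<Rightarrow> nat \<Rightarrow> nat" where
  "block_start n m d i = n - d * m + (i - 1) * m"

definition grid_set :: "nat \<Rightarrow> nat \<Rightarrow> nat \<Rightarrow> nat \<Rightarrow> (nat \<Rightarrow> nat) \<Rightarrow> nat set" where
  "grid_set n m d q x =
     {1..q} \<union> (\<Union>i\<in>{1..d}. {block_start n m d i <.. block_start n m d i + x i})"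

lemma block_start_mono:
  assumes "i \<ge> 1" "i < j"
  shows "block_start n m d i + m \<le> block_start n m d j"
proof -
  have "(i - 1) * m + m = i * m" using assms(1) by (cases i) auto
  also have "\<dots> \<le> (j - 1) * m" using assms(2) by (intro mult_le_mono1) auto
  finally show ?thesis by (simp add: block_start_def)
qed

lemma block_end_le:
  assumes "d * m \<le> n" "i \<in> {1..d}"
  shows "block_start n m d i + m \<le> n"
proof -
  have "(i - 1) * m + m = i * m" using assms(2) by (cases i) auto
  also have "\<dots> \<le> d * m" using assms(2) by (intro mult_le_mono1) auto
  finally show ?thesis using assms(1) by (simp add: block_start_def)
qed

lemma blocks_disjoint:
  assumes "i \<in> {1..d}" "j \<in> {1..d}" "i \<noteq> j" "u \<le> m" "v \<le> m"
  shows "{block_start n m d i + a <.. block_start n m d i + u} \<inter>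
    {block_start n m d j + b <.. block_start n m d j + v} = {}"
proof -
  consider "i < j" | "j < i" using assms(3) by linarith
  then show ?thesis
    using block_start_mono[of i j n m d] block_start_mono[of j i n m d] assms by cases auto
qed

lemma grid_le: "x \<in> grid m d \<Longrightarrow> i \<in> {1..d} \<Longrightarrow> x i \<le> m"
  by (auto simp: grid_def)

lemma card_blocks:
  assumes "x \<in> grid m d"
  shows "card (\<Union>i\<in>{1..d}. {block_start n m d i + y i <.. block_start n m d i + x i})
    = (\<Sum>i\<in>{1..d}. x i - y i)"
proof -
  have "card (\<Union>i\<in>{1..d}. {block_start n m d i + y i <.. block_start n m d i + x i})
    = (\<Sum>i\<in>{1..d}. card {block_start n m d i + y i <.. block_start n m d i + x i})"
    using assms by (intro card_UN_disjoint ballI impI blocks_disjoint) (auto intro: grid_le)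
  then show ?thesis by simp
qed

lemma grid_set_subset:
  assumes "d * m \<le> n" "q \<le> n - d * m" "x \<in> grid m d"
  shows "grid_set n m d q x \<subseteq> {1..n}"
proof -
  have "block_start n m d i + x i \<le> n" if "i \<in> {1..d}" for i
    using block_end_le[OF assms(1) that] grid_le[OF assms(3) that] by linarith
  then show ?thesis using assms by (fastforce simp: grid_set_def)
qed

lemma card_grid_set:
  assumes "q \<le> n - d * m" "x \<in> grid m d"
  shows "card (grid_set n m d q x) = q + (\<Sum>i\<in>{1..d}. x i)"
proof -
  have "{1..q} \<inter> (\<Union>i\<in>{1..d}. {block_start n m d i <.. block_start n m d i + x i}) = {}"
    using assms(1) by (auto simp: block_start_def)
  then show ?thesis
    using card_blocks[OF assms(2), of n "\<lambda>_. 0"] unfolding grid_set_def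
    by (subst card_Un_disjoint) auto
qed

lemma grid_set_diff:
  assumes "q \<le> n - d * m" "x \<in> grid m d" "y \<in> grid m d"
  shows "grid_set n m d q x - grid_set n m d q y =
    (\<Union>i\<in>{1..d}. {block_start n m d i + y i <.. block_start n m d i + x i})" (is "?L = ?R")
proof
  show "?L \<subseteq> ?R" by (auto simp: grid_set_def) (metis not_le atLeastAtMost_iff)
  show "?R \<subseteq> ?L"
  proof
    fix p assume "p \<in> ?R"
    then obtain i where i: "i \<in> {1..d}" "p \<in> {block_start n m d i + y i <.. block_start n m d i + x i}"
      by blast
    have "p \<notin> {1..q}" using i assms(1) by (auto simp: block_start_def)
    moreover have "p \<notin> {block_start n m d j <.. block_start n m d j + y j}" if j: "j \<in> {1..d}" for j
    proof (cases "j = i")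
      case False
      then show ?thesis
        using blocks_disjoint[OF i(1) j, of "x i" m "y j" n "y i" 0] i grid_le[OF assms(2) i(1)]
          grid_le[OF assms(3) j] by auto
    qed (use i in auto)
    moreover have "p \<in> {block_start n m d i <.. block_start n m d i + x i}" using i(2) by simp
    ultimately show "p \<in> ?L" using i(1) unfolding grid_set_def by blast
  qed
qed

lemma card_grid_set_diff:
  assumes "q \<le> n - d * m" "x \<in> grid m d" "y \<in> grid m d"
  shows "card (grid_set n m d q x - grid_set n m d q y) = (\<Sum>i\<in>{1..d}. x i - y i)"
  using grid_set_diff[OF assms] card_blocks[OF assms(2)] by simp

lemma grid_set_subset_iff:
  assumes "q \<le> n - d * m" "x \<in> grid m d" "y \<in> grid m d"
  shows "grid_set n m d q x \<subseteq> grid_set n m d q y \<longleftrightarrow> (\<forall>i\<in>{1..d}. x i \<le> y i)"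
proof -
  have "finite (grid_set n m d q x)" by (simp add: grid_set_def)
  then have "grid_set n m d q x \<subseteq> grid_set n m d q y \<longleftrightarrow> card (grid_set n m d q x - grid_set n m d q y) = 0"
    by auto
  also have "\<dots> \<longleftrightarrow> (\<forall>i\<in>{1..d}. x i - y i = 0)"
    unfolding card_grid_set_diff[OF assms] by (subst sum_eq_0_iff) auto
  finally show ?thesis by simp
qed

lemma inj_on_grid_set:
  assumes "q \<le> n - d * m"
  shows "inj_on (grid_set n m d q) (grid m d)"
proof (rule inj_onI)
  fix x y assume xy: "x \<in> grid m d" "y \<in> grid m d" "grid_set n m d q x = grid_set n m d q y"
  then have "\<forall>i\<in>{1..d}. x i \<le> y i" "\<forall>i\<in>{1..d}. y i \<le> x i"
    using grid_set_subset_iff[OF assms xy(1,2)] grid_set_subset_iff[OF assms xy(2,1)] by auto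
  then have "x i = y i" if "i \<in> {1..d}" for i
    using that by (simp add: le_antisym)
  then show "x = y" using xy(1,2) PiE_ext unfolding grid_def by blast
qed

text \<open>
  Placing a grid in the cube and permuting the ground set is an embedding of posets, so copies of
  \<open>P\<close> are carried to copies of \<open>P\<close>.
\<close>
lemma image_grid_set_copy:
  assumes p: "p permutes {1..n}" and qd: "d * m \<le> n" "q \<le> n - d * m"
    and X: "X \<in> induced_copies_in P r (grid m d) (grid_order m d) G"
    and G: "\<And>x. x \<in> G \<Longrightarrow> p ` grid_set n m d q x \<in> F"
  shows "(\<lambda>x. p ` grid_set n m d q x) ` X \<in> induced_copies_in P r (Pow {1..n}) (cube_order n) F"
proof -
  define S where "S x = p ` grid_set n m d q x" for x
  obtain f where f: "X = f ` P" "f ` P \<subseteq> grid m d" "inj_on f P" "f ` P \<subseteq> G"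
    and fo: "\<And>u v. u \<in> P \<Longrightarrow> v \<in> P \<Longrightarrow> (f u, f v) \<in> grid_order m d - Id \<longleftrightarrow> (u, v) \<in> r - Id"
  proof -
    obtain f where "X = f ` P" "f \<in> P \<rightarrow> grid m d" "inj_on f P" "X \<subseteq> G"
      "\<forall>u\<in>P. \<forall>v\<in>P. (f u, f v) \<in> grid_order m d - Id \<longleftrightarrow> (u, v) \<in> r - Id"
      using X unfolding induced_copies_in_def induced_copies_def by blast
    then show thesis by (intro that[of f]) auto
  qed
  have Sn: "S x \<in> Pow {1..n}" if "x \<in> grid m d" for x
    using grid_set_subset[OF qd that] permutes_image[OF p] by (auto simp: S_def)
  have sub: "S x \<subseteq> S y \<longleftrightarrow> (x, y) \<in> grid_order m d" if "x \<in> grid m d" "y \<in> grid m d" for x y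
    using grid_set_subset_iff[OF qd(2) that] that permutes_inj[OF p]
    by (simp add: S_def inj_image_subset_iff grid_orderD)
  have inj: "inj_on S (grid m d)"
    using inj_on_grid_set[OF qd(2)] permutes_inj[OF p]
    by (auto simp: S_def inj_on_def inj_image_eq_iff)
  have "inj_on (S \<circ> f) P" using f inj by (meson comp_inj_on inj_on_subset)
  moreover have "(S \<circ> f) \<in> P \<rightarrow> Pow {1..n}"
  proof
    fix u assume "u \<in> P"
    then have "f u \<in> grid m d" using f(2) by auto
    then show "(S \<circ> f) u \<in> Pow {1..n}" using Sn by (metis comp_apply)
  qed
  moreover have "((S \<circ> f) u, (S \<circ> f) v) \<in> cube_order n - Id \<longleftrightarrow> (u, v) \<in> r - Id"
    if uv: "u \<in> P" "v \<in> P" for u v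
  proof -
    have g: "f u \<in> grid m d" "f v \<in> grid m d" using f uv by auto
    have "((S \<circ> f) u, (S \<circ> f) v) \<in> cube_order n - Id \<longleftrightarrow> (f u, f v) \<in> grid_order m d - Id"
      using sub[OF g] inj_on_eq_iff[OF inj g] Sn g
      by (auto simp: cube_order_def relation_of_def)
    then show ?thesis using fo uv by simp
  qed
  moreover have "S ` X = (S \<circ> f) ` P" using f by (simp add: image_comp)
  moreover have "S ` X \<subseteq> F" using f G by (auto simp: S_def)
  ultimately have "S ` X \<in> induced_copies_in P r (Pow {1..n}) (cube_order n) F"
    unfolding induced_copies_in_def induced_copies_def mem_Collect_eq
    by (intro conjI exI[of _ "S \<circ> f"] ballI)
  then show ?thesis by (simp add: S_def[abs_def])
qed


section \<open>Permutations with prescribed images\<close>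

text \<open>
  After composing with the inverse of one fixed permutation of the required kind, every other one
  stabilises all parts, hence is determined by a permutation of each part.
\<close>
lemma card_permutes_with_part_images_le:
  fixes X :: "'i \<Rightarrow> 'a set"
  assumes "finite U" "finite I" "(\<Union>i\<in>I. X i) = U"
  shows "card {p. p permutes U \<and> (\<forall>i\<in>I. p ` X i = Y i)} \<le> (\<Prod>i\<in>I. fact (card (X i)))"
proof (cases "{p. p permutes U \<and> (\<forall>i\<in>I. p ` X i = Y i)} = {}")
  case True
  then show ?thesis by (simp only: card.empty le0)
next
  case False
  then obtain q where q: "q permutes U" "\<And>i. i \<in> I \<Longrightarrow> q ` X i = Y i" by blast
  define S where "S = {p. p permutes U \<and> (\<forall>i\<in>I. p ` X i = Y i)}"
  define h where "h p = (\<lambda>i\<in>I. restrict_id (inv q \<circ> p) (X i))" for p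
  have fX: "finite (X i)" if "i \<in> I" for i using assms that by (meson UN_upper finite_subset)
  have iq: "inv q (q x) = x" for x using q(1) by (simp add: permutes_inverses(2))
  have qi: "q (inv q x) = x" for x using q(1) by (simp add: permutes_inverses(1))
  have stab: "(inv q \<circ> p) ` X i = X i" if "p \<in> S" "i \<in> I" for p i
  proof -
    have "p ` X i = q ` X i" using that q S_def by auto
    then have "inv q ` (p ` X i) = inv q ` (q ` X i)" by simp
    then show ?thesis by (simp add: image_comp comp_def iq)
  qed
  have "h ` S \<subseteq> (\<Pi>\<^sub>E i\<in>I. {p. p permutes X i})"
  proof (intro image_subsetI)
    fix p assume p: "p \<in> S"
    show "h p \<in> (\<Pi>\<^sub>E i\<in>I. {p. p permutes X i})"
    proof (rule PiE_I)
      fix i assume i: "i \<in> I"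
      have "inj (inv q \<circ> p)"
        using p q(1) unfolding S_def by (intro permutes_inj[of _ U] permutes_compose permutes_inv) auto
      then have "bij_betw (inv q \<circ> p) (X i) (X i)"
        unfolding bij_betw_def using stab[OF p i] inj_on_subset by blast
      then have "restrict_id (inv q \<circ> p) (X i) permutes X i"
        by (rule permutes_restrict_id)
      then show "h p i \<in> {p. p permutes X i}" using i by (simp add: h_def)
    qed (simp add: h_def)
  qed
  moreover have "inj_on h S"
  proof (rule inj_onI)
    fix p p' assume pp: "p \<in> S" "p' \<in> S" "h p = h p'"
    have "p x = p' x" for x
    proof (cases "x \<in> U")
      case True
      then obtain i where i: "i \<in> I" "x \<in> X i" using assms by blast
      have "h p i x = h p' i x" using pp by simp
      then have "inv q (p x) = inv q (p' x)" using i by (simp add: h_def)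
      then show ?thesis by (metis qi)
    next
      case False
      then show ?thesis using pp by (simp add: S_def permutes_def)
    qed
    then show "p = p'" by blast
  qed
  moreover have "finite (\<Pi>\<^sub>E i\<in>I. {p. p permutes X i})"
    using assms fX by (intro finite_PiE) (auto intro: finite_permutations)
  ultimately have "card S \<le> card (\<Pi>\<^sub>E i\<in>I. {p. p permutes X i})"
    by (meson card_inj_on_le)
  also have "\<dots> = (\<Prod>i\<in>I. fact (card (X i)))"
    using assms fX by (simp add: card_PiE card_permutations)
  finally show ?thesis by (simp add: S_def)
qed

text \<open>
  The bound by parts holds for each of the \<open>card U choose card T\<close> possible images of \<open>T\<close>, and the
  counts add up to the number of all permutations. So the bound is attained every time.
\<close>
lemma card_permutes_image_eq:
  assumes "finite U" "T \<subseteq> U" "A \<subseteq> U" "card A = card T"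
  shows "card {p. p permutes U \<and> p ` T = A} = fact (card T) * fact (card U - card T)"
proof -
  define k where "k = card T"
  define N where "N A = card {p. p permutes U \<and> p ` T = A}" for A
  have le: "N A \<le> fact k * fact (card U - k)" for A
  proof -
    have "N A \<le> card {p. p permutes U \<and> (\<forall>b\<in>UNIV. p ` (if b then T else U - T) = (if b then A else U - A))}"
      unfolding N_def
    proof (rule card_mono)
      show "finite {p. p permutes U \<and> (\<forall>b\<in>UNIV. p ` (if b then T else U - T) = (if b then A else U - A))}"
        using assms(1) by (rule rev_finite_subset[OF finite_permutations]) auto
      show "{p. p permutes U \<and> p ` T = A} \<subseteq> {p. p permutes U \<and> (\<forall>b\<in>UNIV. p ` (if b then T else U - T) = (if b then A else U - A))}"
      proof (intro subsetI CollectI conjI ballI; clarify)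
        fix p and b :: bool assume "p permutes U"
        then have "inj p" "p ` U = U" by (simp_all add: permutes_inj permutes_image)
        then show "p ` (if b then T else U - T) = (if b then p ` T else U - p ` T)"
          by (simp add: image_set_diff)
      qed
    qed
    also have "\<dots> \<le> (\<Prod>b\<in>UNIV. fact (card (if b then T else U - T)))"
      using assms by (intro card_permutes_with_part_images_le) auto
    also have "\<dots> = fact k * fact (card U - k)"
      using assms by (simp add: UNIV_bool card_Diff_subset finite_subset k_def)
    finally show ?thesis .
  qed
  define L where "L = {B. B \<subseteq> U \<and> card B = k}"
  have fL: "finite L" using assms(1) by (auto simp: L_def)
  have "{p. p permutes U} = (\<Union>B\<in>L. {p. p permutes U \<and> p ` T = B})"
  proof -
    have "p ` T \<in> L" if "p permutes U" for p
      using that assms(2) permutes_image[OF that] permutes_inj[OF that]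
      by (auto simp: L_def k_def card_image inj_on_subset)
    then show ?thesis by auto
  qed
  then have "fact (card U) = card (\<Union>B\<in>L. {p. p permutes U \<and> p ` T = B})"
    using assms(1) by (metis card_permutations)
  also have "\<dots> = (\<Sum>B\<in>L. N B)"
    unfolding N_def using fL assms(1)
    by (intro card_UN_disjoint) (auto intro: rev_finite_subset[OF finite_permutations])
  finally have tot: "(\<Sum>B\<in>L. N B) = fact (card U)" by simp
  have "card L = card U choose k" using assms by (simp add: L_def n_subsets)
  moreover have kU: "k \<le> card U" using assms by (simp add: k_def card_mono)
  ultimately have "(\<Sum>B\<in>L. fact k * fact (card U - k)) = (fact (card U) :: nat)"
    using binomial_fact_lemma[OF kU] by (simp add: mult.commute)
  then have "(\<Sum>B\<in>L. (fact k * fact (card U - k) :: nat)) = (\<Sum>B\<in>L. N B)" using tot by simp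
  then have "\<forall>B\<in>L. N B = fact k * fact (card U - k)"
    using sum_mono_inv[of N L "\<lambda>_. fact k * fact (card U - k)"] le fL by metis
  then show ?thesis using assms by (simp add: L_def N_def k_def)
qed

text \<open>
  The four parts cut out by \<open>T\<close> and \<open>T'\<close> are mapped to the corresponding parts of \<open>A\<close> and \<open>B\<close>.
  In probabilistic terms: given the image of \<open>T\<close>, the image of \<open>T'\<close> has to be one particular
  choice among all sets that differ from it by as many elements on either side.
\<close>
lemma card_permutes_two_images_le:
  assumes "finite U" "T \<subseteq> U" "T' \<subseteq> U"
  shows "card {p. p permutes U \<and> p ` T = A \<and> p ` T' = B}
      * ((card T choose card (T - T')) * ((card U - card T) choose card (T' - T)))
    \<le> fact (card T) * fact (card U - card T)"
proof -
  define part where "part T T' i = (if fst i then (if snd i then T \<inter> T' else T - T')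
     else (if snd i then T' - T else U - T - T'))" for T T' :: "'a set" and i :: "bool \<times> bool"
  have fin: "finite T" "finite T'" using assms finite_subset by auto
  have I: "(UNIV :: (bool \<times> bool) set) = {(True,True),(True,False),(False,True),(False,False)}"
    by auto
  have "card {p. p permutes U \<and> p ` T = A \<and> p ` T' = B}
     \<le> card {p. p permutes U \<and> (\<forall>i\<in>UNIV. p ` part T T' i = part A B i)}"
  proof (rule card_mono)
    show "finite {p. p permutes U \<and> (\<forall>i\<in>UNIV. p ` part T T' i = part A B i)}"
      using assms(1) by (rule rev_finite_subset[OF finite_permutations]) auto
    show "{p. p permutes U \<and> p ` T = A \<and> p ` T' = B}
      \<subseteq> {p. p permutes U \<and> (\<forall>i\<in>UNIV. p ` part T T' i = part A B i)}"
    proof (intro subsetI CollectI conjI ballI; clarify)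
      fix p and i :: "bool \<times> bool" assume "p permutes U"
      then have "inj p" "p ` U = U" by (simp_all add: permutes_inj permutes_image)
      then show "p ` part T T' i = part (p ` T) (p ` T') i"
        by (simp add: part_def image_set_diff image_Int)
    qed
  qed
  also have "\<dots> \<le> (\<Prod>i\<in>UNIV. fact (card (part T T' i)))"
    using assms by (intro card_permutes_with_part_images_le) (auto simp: part_def I)
  also have "\<dots> = fact (card (T \<inter> T')) * fact (card (T - T')) * (fact (card (T' - T)) * fact (card (U - T - T')))"
    unfolding I by (simp add: part_def)
  finally have le: "card {p. p permutes U \<and> p ` T = A \<and> p ` T' = B} \<le> \<dots>" .
  define a b k l where "a = card (T - T')" and "b = card (T' - T)" and "k = card T" and "l = card U - card T"
  have ak: "a \<le> k" "card (T \<inter> T') = k - a"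
    using fin by (auto simp: a_def k_def card_mono) (metis Diff_Diff_Int Diff_subset card_Diff_subset finite_Diff)
  have l: "l = card (U - T)" using assms fin by (simp add: l_def card_Diff_subset)
  have "U - T - T' = (U - T) - (T' - T)" by auto
  moreover have sub: "T' - T \<subseteq> U - T" using assms by auto
  moreover have "b \<le> l" unfolding b_def l using assms(1) sub by (intro card_mono) auto
  ultimately have bl: "b \<le> l" "card (U - T - T') = l - b"
    using fin by (simp_all add: b_def l card_Diff_subset)
  have "card {p. p permutes U \<and> p ` T = A \<and> p ` T' = B} * ((k choose a) * (l choose b))
    \<le> fact (k - a) * fact a * (fact b * fact (l - b)) * ((k choose a) * (l choose b))"
    using le ak bl by (simp add: a_def b_def)
  also have "\<dots> = (fact a * fact (k - a) * (k choose a)) * (fact b * fact (l - b) * (l choose b))"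
    by (simp add: algebra_simps)
  also have "\<dots> = fact k * fact l"
    using binomial_fact_lemma[OF ak(1)] binomial_fact_lemma[OF bl(1)] by simp
  finally show ?thesis by (simp add: a_def b_def k_def l_def)
qed


section \<open>Estimates for binomial coefficients\<close>

lemma power_le_const_exp2: "\<exists>B>0. \<forall>a. real (a + 1) ^ e \<le> B * 2 ^ a"
proof (cases "e = 0")
  case True
  then show ?thesis by (intro exI[of _ 1]) simp
next
  case False
  have "real (a + 1) ^ e \<le> (real e ^ e * 2 ^ e) * 2 ^ a" for a
  proof -
    have "(real (a + e) / real e) ^ e \<le> real ((a + e) choose e)"
      by (rule binomial_ge_n_over_k_pow_k) simp
    also have "\<dots> \<le> 2 ^ (a + e)"
      using binomial_le_pow2[of "a + e" e] by (metis of_nat_le_iff of_nat_numeral of_nat_power)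
    finally have "real (a + e) ^ e \<le> real e ^ e * 2 ^ (a + e)"
      using False by (simp add: power_divide field_simps)
    moreover have "real (a + 1) ^ e \<le> real (a + e) ^ e" using False by (intro power_mono) auto
    ultimately show ?thesis by (simp add: power_add mult_ac)
  qed
  then show ?thesis using False by (intro exI[of _ "real e ^ e * 2 ^ e"]) auto
qed

text \<open>
  For \<open>a = s\<close> this is the usual bound for \<open>k choose s\<close>. Beyond \<open>s\<close>, the binomial coefficient grows
  exponentially up to \<open>k / 2\<close>, which outweighs the polynomial factor. It makes distances larger
  than \<open>s\<close> harmless, although the number of grid points at distance \<open>a\<close> grows with \<open>a\<close>.
\<close>
lemma power_mult_power_le_const_binomial:
  "\<exists>c>0. \<forall>a k. s \<le> a \<longrightarrow> 2 * a \<le> k \<longrightarrow>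
     real (a + 1) ^ d * real k ^ s \<le> c * real (k choose a)"
proof -
  obtain B where B: "B > 0" "\<And>a. real (a + 1) ^ (d + s) \<le> B * 2 ^ a"
    using power_le_const_exp2 by blast
  define c where "c = (real s ^ s + 1) * 2 ^ s * B"
  have "real (a + 1) ^ d * real k ^ s \<le> c * real (k choose a)" if a: "s \<le> a" "2 * a \<le> k" for a k
  proof -
    have "(2::real) ^ (a - s) \<le> real ((k - s) choose (a - s))"
    proof (cases "a = s")
      case False
      then have "(2::real) ^ (a - s) \<le> (real (k - s) / real (a - s)) ^ (a - s)"
        using a by (intro power_mono) (auto simp: field_simps of_nat_diff)
      also have "\<dots> \<le> real ((k - s) choose (a - s))"
        using a by (intro binomial_ge_n_over_k_pow_k) auto
      finally show ?thesis .
    qed simp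
    then have 1: "(2::real) ^ a \<le> 2 ^ s * real ((k - s) choose (a - s))"
      using a by (simp add: power_diff field_simps)
    have 2: "real k ^ s \<le> (real s ^ s + 1) * real (k choose s)"
    proof (cases "s = 0")
      case False
      have "(real k / real s) ^ s \<le> real (k choose s)"
        using a by (intro binomial_ge_n_over_k_pow_k) auto
      then have "real k ^ s \<le> real s ^ s * real (k choose s)"
        using False by (simp add: power_divide field_simps)
      then show ?thesis by (simp add: algebra_simps)
    qed simp
    have 3: "real (a choose s) \<le> real (a + 1) ^ s"
    proof -
      have "real (a choose s) \<le> real (a ^ s)" using binomial_le_pow a by (simp only: of_nat_le_iff)
      also have "\<dots> \<le> real (a + 1) ^ s" by (simp add: power_mono)
      finally show ?thesis .
    qed
    have pos: "real (a choose s) > 0" using a by simp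
    have eq: "real (k choose a) * real (a choose s) = real (k choose s) * real ((k - s) choose (a - s))"
      using choose_mult[of s a k] a by (metis le_add2 le_trans mult_2 of_nat_mult)
    have "real (a + 1) ^ d * real k ^ s * real (a choose s)
      \<le> real (a + 1) ^ d * ((real s ^ s + 1) * real (k choose s)) * real (a + 1) ^ s"
      by (intro mult_mono 2 3 order_refl) auto
    also have "\<dots> = real (a + 1) ^ (d + s) * ((real s ^ s + 1) * real (k choose s))"
      by (simp add: power_add)
    also have "\<dots> \<le> (B * (2 ^ s * real ((k - s) choose (a - s)))) * ((real s ^ s + 1) * real (k choose s))"
    proof (intro mult_right_mono)
      have "real (a + 1) ^ (d + s) \<le> B * 2 ^ a" by (rule B)
      also have "\<dots> \<le> B * (2 ^ s * real ((k - s) choose (a - s)))"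
        using B(1) 1 by (intro mult_left_mono) auto
      finally show "real (a + 1) ^ (d + s) \<le> B * (2 ^ s * real ((k - s) choose (a - s)))" .
    qed auto
    also have "\<dots> = c * (real (k choose s) * real ((k - s) choose (a - s)))"
      by (simp add: c_def mult_ac)
    also have "\<dots> = c * real (k choose a) * real (a choose s)" using eq by (simp add: mult.assoc)
    finally show ?thesis using pos by simp
  qed
  moreover have "c > 0" using B(1) by (simp add: c_def add_nonneg_pos)
  ultimately show ?thesis by blast
qed

lemma linear_times_geometric_lt_1:
  fixes q u v :: real
  assumes "0 \<le> q" "q < 1"
  shows "\<exists>J. \<forall>j\<ge>J. (u * real j + v) * q ^ j < 1"
proof -
  have "(\<lambda>j. u * (real j * q ^ j) + v * q ^ j) \<longlonglongrightarrow> u * 0 + v * 0"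
    using assms by (intro tendsto_intros powser_times_n_limit_0 LIMSEQ_power_zero) auto
  then have "\<forall>\<^sub>F j in sequentially. u * (real j * q ^ j) + v * q ^ j < 1"
    by (rule order_tendstoD) simp
  then show ?thesis by (simp add: eventually_sequentially algebra_simps)
qed

lemma binomial_le_geometric:
  fixes q :: real
  assumes q: "0 \<le> q" and ratio: "\<And>i. i < k + j \<Longrightarrow> real (i + 1) \<le> q * real (n - i)" and "k + j \<le> n"
  shows "real (n choose k) \<le> q ^ j * real (n choose (k + j))"
  using ratio assms(3)
proof (induction j)
  case (Suc j)
  have pos: "real (n - (k + j)) > 0" using Suc.prems by simp
  have "(k + j + 1) * (n choose (k + j + 1)) = (n - (k + j)) * (n choose (k + j))"
    using binomial_absorb_comp[of n "k + j"] binomial_absorption[of "k+j" n]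
    by (metis Suc_eq_plus1 mult.commute binomial_absorption choose_reduce_nat)
  then have eq: "real (k + j + 1) * real (n choose (k + j + 1)) = real (n - (k + j)) * real (n choose (k + j))"
    by (metis of_nat_mult)
  have "real (n - (k + j)) * real (n choose (k + j)) \<le> q * real (n - (k + j)) * real (n choose (k + j + 1))"
    unfolding eq[symmetric] by (intro mult_right_mono Suc.prems(1)) auto
  then have step: "real (n choose (k + j)) \<le> q * real (n choose (k + j + 1))"
    using pos by (simp add: mult.assoc mult.left_commute)
  have "real (n choose k) \<le> q ^ j * real (n choose (k + j))" using Suc by simp
  also have "\<dots> \<le> q ^ j * (q * real (n choose (k + j + 1)))"
    using step q by (intro mult_left_mono) auto
  finally show ?case by (simp add: mult_ac)
qed simp

text \<open>
  At a distance linear in \<open>n\<close> from the middle, consecutive binomial coefficients have ratio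
  bounded away from 1, so there \<open>n choose k\<close> is exponentially smaller than the central one.
\<close>
lemma large_binomial_near_middle:
  assumes "D \<ge> (1::nat)"
  shows "\<exists>N. \<forall>n\<ge>N. \<forall>k\<le>n. n choose (n div 2) \<le> (n + 1) * (n choose k) \<longrightarrow>
    real D * \<bar>2 * real k - real n\<bar> \<le> real n"
proof -
  define q where "q = (2 * real D - 1) / (2 * real D + 1)"
  have q: "0 \<le> q" "q < 1" using assms by (auto simp: q_def)
  obtain J where J: "\<And>j. j \<ge> J \<Longrightarrow> (4 * real D * real j + (4 * real D + 1)) * q ^ j < 1"
    using linear_times_geometric_lt_1[OF q] by blast
  have half: "real D * (real n - 2 * real k) \<le> real n"
    if n: "n \<ge> 4 * D * J" and k: "k \<le> n" and big: "n choose (n div 2) \<le> (n + 1) * (n choose k)" for n k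
  proof (rule ccontr)
    assume "\<not> ?thesis"
    then have far: "real n < real D * (real n - 2 * real k)" by simp
    have kn: "2 * k < n"
    proof (rule ccontr)
      assume "\<not> ?thesis"
      then have "real D * (real n - 2 * real k) \<le> 0" by (intro mult_nonneg_nonpos) auto
      then show False using far by linarith
    qed
    \<comment> \<open>From \<open>k\<close>, walk half of the way to the middle; every step gains at least a factor \<open>1 / q\<close>.\<close>
    define j where "j = (n - 2 * k) div 4"
    have "real n < real (D * (n - 2 * k))" using far kn by (simp add: of_nat_diff)
    then have nD: "n < D * (n - 2 * k)" by linarith
    have "n - 2 * k < 4 * j + 4" unfolding j_def by linarith
    then have nj: "n < D * (4 * j + 4)" using nD by (meson less_imp_le_nat less_le_trans mult_le_mono2)
    have "4 * D * J < 4 * D * (j + 1)" using n nj by (simp add: algebra_simps)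
    then have "J < j + 1" using nat_mult_less_cancel_disj by blast
    then have "J \<le> j" by simp
    have j4: "4 * real j \<le> real n - 2 * real k" using kn unfolding j_def by linarith
    have "real (n choose k) \<le> q ^ j * real (n choose (k + j))"
    proof (rule binomial_le_geometric[OF q(1)])
      fix i assume i: "i < k + j"
      have "i + 1 \<le> k + j" using i by simp
      then have "real (i + 1) \<le> real (k + j)" by (simp only: of_nat_le_iff)
      then have kj: "4 * (real i + 1) \<le> real n + 2 * real k" using j4 by simp
      have "(2 * real D + 1) * (real i + 1) \<le> (2 * real D - 1) * (real n - real i)"
      proof -
        have "4 * D * (real i + 1) \<le> D * (real n + 2 * real k)"
          using mult_left_mono[OF kj, of "real D"] by (simp add: mult_ac)
        moreover have "real D * (2 * real k) \<le> real D * real n - real n" using far by (simp add: algebra_simps)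
        moreover have "real D \<ge> 1" using assms by simp
        ultimately show ?thesis by (simp add: algebra_simps)
      qed
      moreover have "real (n - i) = real n - real i" using i kn j_def by (simp add: of_nat_diff)
      ultimately show "real (i + 1) \<le> q * real (n - i)" using assms by (simp add: q_def field_simps)
    qed (use kn j_def in auto)
    also have "\<dots> \<le> q ^ j * real (n choose (n div 2))"
      using q by (intro mult_left_mono) (auto simp: binomial_maximum)
    finally have 1: "real (n choose k) \<le> q ^ j * real (n choose (n div 2))" .
    have "real (n choose (n div 2)) \<le> real ((n + 1) * (n choose k))" using big by (simp only: of_nat_le_iff)
    also have "\<dots> \<le> (real n + 1) * (q ^ j * real (n choose (n div 2)))"
      unfolding of_nat_mult of_nat_add of_nat_1 using 1 by (intro mult_left_mono) auto
    finally have "1 \<le> (real n + 1) * q ^ j" by (simp add: mult.assoc[symmetric])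
    also have "\<dots> \<le> (4 * real D * real j + (4 * real D + 1)) * q ^ j"
    proof (intro mult_right_mono)
      have "real n < real (D * (4 * j + 4))" using nj by (simp only: of_nat_less_iff)
      then show "real n + 1 \<le> 4 * real D * real j + (4 * real D + 1)" by (simp add: algebra_simps)
    qed (use q in auto)
    finally show False using J[OF \<open>J \<le> j\<close>] by simp
  qed
  show ?thesis
  proof (intro exI[of _ "4 * D * J"] allI impI)
    fix n k assume *: "n \<ge> 4 * D * J" "k \<le> n" "n choose (n div 2) \<le> (n + 1) * (n choose k)"
    have "real D * (real n - 2 * real k) \<le> real n" using half * by blast
    moreover have "real D * (real n - 2 * real (n - k)) \<le> real n"
      using half[of n "n - k"] * binomial_symmetric[of k n] by simp
    ultimately show "real D * \<bar>2 * real k - real n\<bar> \<le> real n"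
      using *(2) by (simp add: of_nat_diff abs_if algebra_simps)
  qed
qed


section \<open>Concentration of coordinate sums\<close>

lemma sum_PiE_insert:
  fixes g :: "('i \<Rightarrow> 'a) \<Rightarrow> 'b :: comm_monoid_add"
  assumes "j \<notin> I"
  shows "(\<Sum>x\<in>insert j I \<rightarrow>\<^sub>E A. g x) = (\<Sum>a\<in>A. \<Sum>x\<in>I \<rightarrow>\<^sub>E A. g (x(j := a)))"
proof -
  have "(\<Sum>x\<in>insert j I \<rightarrow>\<^sub>E A. g x) = (\<Sum>(a, x)\<in>A \<times> (I \<rightarrow>\<^sub>E A). g (x(j := a)))"
    unfolding PiE_insert_eq using inj_combinator[OF assms, of "\<lambda>_. A"]
    by (subst sum.reindex) (auto simp: case_prod_beta)
  then show ?thesis by (simp add: sum.cartesian_product)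
qed

text \<open>
  The second moment of a sum of independent centred variables, in counting form: all mixed terms
  vanish because \<open>y\<close> sums to zero.
\<close>
lemma sum_PiE_square_of_sum:
  fixes y :: "'a \<Rightarrow> real"
  assumes "finite I" "finite A" "(\<Sum>a\<in>A. y a) = 0"
  shows "real (card A) * (\<Sum>x\<in>I \<rightarrow>\<^sub>E A. (\<Sum>i\<in>I. y (x i))\<^sup>2)
    = real (card I) * real (card A) ^ card I * (\<Sum>a\<in>A. (y a)\<^sup>2)"
  using assms(1)
proof induction
  case (insert j I)
  define L where "L = I \<rightarrow>\<^sub>E A"
  define t where "t x = (\<Sum>i\<in>I. y (x i))" for x
  have cL: "real (card L) = real (card A) ^ card I" using insert by (simp add: L_def card_PiE)
  have up: "(\<Sum>i\<in>insert j I. y ((x(j := a)) i)) = y a + t x" for x a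
  proof -
    have "(\<Sum>i\<in>I. y ((x(j := a)) i)) = t x" unfolding t_def
      using insert.hyps by (intro sum.cong) auto
    then show ?thesis using insert.hyps by simp
  qed
  have "(\<Sum>x\<in>insert j I \<rightarrow>\<^sub>E A. (\<Sum>i\<in>insert j I. y (x i))\<^sup>2) = (\<Sum>a\<in>A. \<Sum>x\<in>L. (y a + t x)\<^sup>2)"
    by (simp only: sum_PiE_insert[OF insert.hyps(2)] up L_def)
  also have "\<dots> = (\<Sum>a\<in>A. real (card L) * (y a)\<^sup>2 + y a * (2 * (\<Sum>x\<in>L. t x)) + (\<Sum>x\<in>L. (t x)\<^sup>2))"
    by (intro sum.cong refl) (simp add: power2_sum sum.distrib sum_distrib_left sum_distrib_right mult_ac)
  also have "\<dots> = real (card L) * (\<Sum>a\<in>A. (y a)\<^sup>2) + (\<Sum>a\<in>A. y a) * (2 * (\<Sum>x\<in>L. t x)) + real (card A) * (\<Sum>x\<in>L. (t x)\<^sup>2)"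
    by (simp only: sum.distrib flip: sum_distrib_left sum_distrib_right) simp
  also have "\<dots> = real (card A) ^ card I * (\<Sum>a\<in>A. (y a)\<^sup>2) + real (card A) * (\<Sum>x\<in>L. (t x)\<^sup>2)"
    using assms(3) cL by simp
  also have "\<dots> = real (card A) ^ card I * (\<Sum>a\<in>A. (y a)\<^sup>2) + real (card I) * real (card A) ^ card I * (\<Sum>a\<in>A. (y a)\<^sup>2)"
    using insert.IH by (simp add: L_def t_def)
  finally show ?case using insert.hyps by (simp add: algebra_simps)
qed simp

lemma sum_centred_interval: "(\<Sum>a\<in>{1..m::nat}. 2 * real a - (real m + 1)) = 0"
proof -
  have "(\<Sum>a\<in>{1..m}. real a) = real m * (real m + 1) / 2" by (induction m) (auto simp: field_simps)
  then show ?thesis by (simp add: sum_subtractf flip: sum_distrib_left)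
qed

text \<open>
  Chebyshev's inequality for the coordinate sum of a uniform grid point. The doubled sum, centred,
  avoids fractions.
\<close>
lemma card_grid_far_from_centre:
  assumes m: "m \<ge> 1" and r: "d \<le> r\<^sup>2" "r \<ge> 1"
  shows "4 * real (card {x \<in> {1..d} \<rightarrow>\<^sub>E {1..m}. 2 * real r * real m
      \<le> \<bar>2 * real (\<Sum>i\<in>{1..d}. x i) - real d * (real m + 1)\<bar>}) \<le> real m ^ d"
    (is "4 * real (card ?B) \<le> _")
proof -
  define y where "y a = 2 * real a - (real m + 1)" for a
  have T: "2 * real (\<Sum>i\<in>{1..d}. x i) - real d * (real m + 1) = (\<Sum>i\<in>{1..d}. y (x i))" for x :: "nat \<Rightarrow> nat"
    by (simp add: y_def sum_subtractf sum_distrib_left)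
  have fin: "finite ({1..d} \<rightarrow>\<^sub>E {1..m})" by (intro finite_PiE) auto
  have "real m * (\<Sum>x\<in>{1..d} \<rightarrow>\<^sub>E {1..m}. (\<Sum>i\<in>{1..d}. y (x i))\<^sup>2)
     = real d * real m ^ d * (\<Sum>a\<in>{1..m}. (y a)\<^sup>2)"
    using sum_PiE_square_of_sum[of "{1..d}" "{1..m}" y] sum_centred_interval[of m] by (simp add: y_def)
  also have "\<dots> \<le> real d * real m ^ d * (\<Sum>a\<in>{1..m}. (real m)\<^sup>2)"
    by (intro mult_left_mono sum_mono) (auto simp: y_def abs_le_square_iff[symmetric])
  finally have V: "(\<Sum>x\<in>{1..d} \<rightarrow>\<^sub>E {1..m}. (\<Sum>i\<in>{1..d}. y (x i))\<^sup>2) \<le> real d * real m ^ d * (real m)\<^sup>2"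
    using m by (simp add: mult_ac)
  have "real (card ?B) * (2 * real r * real m)\<^sup>2 = (\<Sum>x\<in>?B. (2 * real r * real m)\<^sup>2)" by simp
  also have "\<dots> \<le> (\<Sum>x\<in>?B. (\<Sum>i\<in>{1..d}. y (x i))\<^sup>2)"
    unfolding T by (intro sum_mono) (auto simp: abs_le_square_iff[symmetric])
  also have "\<dots> \<le> (\<Sum>x\<in>{1..d} \<rightarrow>\<^sub>E {1..m}. (\<Sum>i\<in>{1..d}. y (x i))\<^sup>2)"
    using fin by (intro sum_mono2) auto
  also have "\<dots> \<le> (real r)\<^sup>2 * real m ^ d * (real m)\<^sup>2"
  proof -
    have "real d \<le> (real r)\<^sup>2" using r(1) by (metis of_nat_le_iff of_nat_power)
    then show ?thesis by (intro order_trans[OF V] mult_right_mono) auto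
  qed
  finally have "(real r)\<^sup>2 * (real m)\<^sup>2 * (4 * real (card ?B)) \<le> (real r)\<^sup>2 * (real m)\<^sup>2 * real m ^ d"
    by (simp add: power_mult_distrib mult_ac)
  then show ?thesis using m r by simp
qed


section \<open>A far pair is rarely seen by a grid\<close>

lemma card_bounded_differences_le:
  assumes "x \<in> grid m d"
  shows "card {y \<in> grid m d. (\<Sum>i\<in>{1..d}. x i - y i) = a \<and> (\<Sum>i\<in>{1..d}. y i - x i) = b}
    \<le> (a + 1) ^ d * (b + 1) ^ d" (is "card ?Y \<le> _")
proof -
  define h where "h y = ((\<lambda>i\<in>{1..d}. x i - y i), (\<lambda>i\<in>{1..d}. y i - x i))" for y :: "nat \<Rightarrow> nat"
  have "h ` ?Y \<subseteq> ({1..d} \<rightarrow>\<^sub>E {0..a}) \<times> ({1..d} \<rightarrow>\<^sub>E {0..b})"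
    by (auto simp: h_def intro!: member_le_sum[where f = "\<lambda>i. x i - _ i"] member_le_sum[where f = "\<lambda>i. _ i - x i"])
  moreover have "inj_on h ?Y"
  proof (rule inj_onI)
    fix y z assume yz: "y \<in> ?Y" "z \<in> ?Y" "h y = h z"
    have "y i = z i" if "i \<in> {1..d}" for i
    proof -
      have "x i - y i = x i - z i" "y i - x i = z i - x i"
        using yz(3) that by (auto simp: h_def dest: fun_cong[where x=i])
      then show ?thesis by linarith
    qed
    then show "y = z" using yz(1,2) PiE_ext unfolding grid_def by blast
  qed
  ultimately have "card ?Y \<le> card (({1..d} \<rightarrow>\<^sub>E {0..a}) \<times> ({1..d} \<rightarrow>\<^sub>E {0..b}))"
    by (intro card_inj_on_le[of h]) (auto intro: finite_PiE)
  then show ?thesis by (simp add: card_cartesian_product card_PiE)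
qed

lemma sum_grid_coords_le: "x \<in> grid m d \<Longrightarrow> (\<Sum>i\<in>{1..d}. x i - y i) \<le> d * m"
  using sum_bounded_above[of "{1..d}" "\<lambda>i. x i - y i" m]
  by (fastforce dest: grid_le intro: le_trans[OF diff_le_self])

text \<open>
  The point \<open>y\<close> of the pair must have prescribed total positive and negative differences from \<open>x\<close>,
  namely the sizes \<open>a\<close> and \<open>b\<close> of \<open>A - B\<close> and \<open>B - A\<close>. This leaves at most
  \<open>(a + 1)\<^sup>d (b + 1)\<^sup>d\<close> candidates, and each is hit by a fraction
  \<open>1 / ((k choose a) ((n - k) choose b))\<close> of the permutations that map the set of \<open>x\<close> to \<open>A\<close>.
  As \<open>a \<ge> s\<close>, the binomial coefficients win by a factor \<open>k\<^sup>s\<close>.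
\<close>
lemma far_pair_count:
  assumes c: "c > 0" "\<And>a k. s \<le> a \<Longrightarrow> 2 * a \<le> k \<Longrightarrow> real (a + 1) ^ d * real k ^ s \<le> c * real (k choose a)"
    and c': "c' > 0" "\<And>a k. 2 * a \<le> k \<Longrightarrow> real (a + 1) ^ d \<le> c' * real (k choose a)"
    and d: "d \<ge> 1" and dm: "d * m \<le> n" and q: "q \<le> n - d * m"
    and x: "x \<in> grid m d" "q + (\<Sum>i\<in>{1..d}. x i) = k"
    and k: "2 * (d * m) \<le> k" "2 * (d * m) \<le> n - k" "k \<le> n"
  shows "real (card {p. p permutes {1..n} \<and> p ` grid_set n m d q x = A \<and>
     (\<exists>y\<in>grid m d. y 1 + s \<le> x 1 \<and> p ` grid_set n m d q y = B)}) * real k ^ s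
     \<le> c * c' * (fact k * fact (n - k))"
proof -
  define S where "S = grid_set n m d q"
  define a b where "a = card (A - B)" and "b = card (B - A)"
  define Q where "Q y = {p. p permutes {1..n} \<and> p ` S x = A \<and> p ` S y = B}" for y
  define Y where "Y = {y \<in> grid m d. y 1 + s \<le> x 1 \<and> Q y \<noteq> {}}"
  define Z where "Z = {p. p permutes {1..n} \<and> p ` S x = A \<and> (\<exists>y\<in>grid m d. y 1 + s \<le> x 1 \<and> p ` S y = B)}"
  have cS: "card (S x) = k" using card_grid_set[OF q x(1)] x(2) by (simp add: S_def)
  have Ssub: "S y \<subseteq> {1..n}" if "y \<in> grid m d" for y
    using grid_set_subset[OF dm q that] by (simp add: S_def)
  have ab: "card (S x - S y) = a \<and> card (S y - S x) = b" if y: "y \<in> Y" for y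
  proof -
    obtain p where p: "p permutes {1..n}" "p ` S x = A" "p ` S y = B" using y by (auto simp: Y_def Q_def)
    have inj: "inj p" using p by (simp add: permutes_inj)
    have "A - B = p ` (S x - S y)" "B - A = p ` (S y - S x)" using p inj by (auto simp: image_set_diff)
    then show ?thesis using inj by (simp add: a_def b_def card_image inj_on_subset)
  qed
  have diffs: "(\<Sum>i\<in>{1..d}. x i - y i) = a" "(\<Sum>i\<in>{1..d}. y i - x i) = b" if y: "y \<in> Y" for y
    using ab[OF y] card_grid_set_diff[OF q x(1), of y] card_grid_set_diff[OF q _ x(1), of y] y
    by (auto simp: S_def Y_def)
  have ZQ: "Z = (\<Union>y\<in>Y. Q y)" by (auto simp: Z_def Y_def Q_def)
  have finY: "finite Y" by (simp add: Y_def)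
  show ?thesis
  proof (cases "Y = {}")
    case True
    then have "Z = {}" using ZQ by simp
    then show ?thesis unfolding S_def[symmetric] Z_def[symmetric] using c c' by simp
  next
    case False
    then obtain y where y: "y \<in> Y" by blast
    have "x 1 - y 1 \<le> a" unfolding diffs(1)[OF y, symmetric] using d
      by (intro member_le_sum[where f = "\<lambda>i. x i - y i"]) auto
    then have sa: "s \<le> a" using y by (auto simp: Y_def)
    have a2: "2 * a \<le> k" using diffs(1)[OF y] sum_grid_coords_le[OF x(1), of y] k by linarith
    have b2: "2 * b \<le> n - k" using diffs(2)[OF y] sum_grid_coords_le[of y m d x] y k unfolding Y_def by fastforce
    define N where "N = real (k choose a) * real ((n - k) choose b)"
    have Npos: "N > 0" using a2 b2 by (simp add: N_def)
    have Q: "real (card (Q y)) * N \<le> fact k * fact (n - k)" if y: "y \<in> Y" for y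
    proof -
      have "card (Q y) * ((k choose a) * ((n - k) choose b)) \<le> fact k * fact (n - k)"
        using card_permutes_two_images_le[of "{1..n}" "S x" "S y" A B] Ssub x y cS ab[OF y]
        by (simp add: Q_def Y_def)
      then have "real (card (Q y) * ((k choose a) * ((n - k) choose b))) \<le> real (fact k * fact (n - k))"
        by (simp only: of_nat_le_iff)
      then show ?thesis by (simp add: N_def)
    qed
    have "Y \<subseteq> {y \<in> grid m d. (\<Sum>i\<in>{1..d}. x i - y i) = a \<and> (\<Sum>i\<in>{1..d}. y i - x i) = b}"
      using diffs by (auto simp: Y_def)
    then have "card Y \<le> card {y \<in> grid m d. (\<Sum>i\<in>{1..d}. x i - y i) = a \<and> (\<Sum>i\<in>{1..d}. y i - x i) = b}"
      by (intro card_mono) auto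
    then have "card Y \<le> (a + 1) ^ d * (b + 1) ^ d"
      using card_bounded_differences_le[OF x(1), of a b] by linarith
    then have cY: "real (card Y) \<le> real (a + 1) ^ d * real (b + 1) ^ d"
      by (metis of_nat_le_iff of_nat_mult of_nat_power)
    have "real (card Z) * N \<le> (\<Sum>y\<in>Y. real (card (Q y))) * N"
      unfolding ZQ using card_UN_le[OF finY, of Q] Npos
      by (intro mult_right_mono) (auto simp flip: of_nat_sum)
    also have "\<dots> \<le> real (card Y) * (fact k * fact (n - k))"
      using sum_bounded_above[of Y "\<lambda>y. real (card (Q y)) * N", OF Q] by (simp add: sum_distrib_right)
    also have "\<dots> \<le> (real (a + 1) ^ d * real (b + 1) ^ d) * (fact k * fact (n - k))"
      by (intro mult_right_mono cY) simp
    finally have "real (card Z) * N * real k ^ s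
       \<le> (real (a + 1) ^ d * real (b + 1) ^ d) * (fact k * fact (n - k)) * real k ^ s"
      by (intro mult_right_mono) auto
    also have "\<dots> = (real (a + 1) ^ d * real k ^ s) * real (b + 1) ^ d * (fact k * fact (n - k))"
      by (simp add: mult_ac)
    also have "\<dots> \<le> (c * real (k choose a)) * (c' * real ((n - k) choose b)) * (fact k * fact (n - k))"
      using c(1) by (intro mult_right_mono mult_mono c(2)[OF sa a2] c'(2)[OF b2]) auto
    also have "\<dots> = c * c' * (fact k * fact (n - k)) * N" by (simp add: N_def mult_ac)
    finally have "real (card Z) * real k ^ s * N \<le> c * c' * (fact k * fact (n - k)) * N"
      by (simp add: mult_ac)
    then show ?thesis using Npos by (simp add: Z_def S_def)
  qed
qed


section \<open>Averaging over random grids\<close>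

text \<open>
  The threshold \<open>n + 1\<close> is coarse. It makes the sets of all other sizes negligible by a trivial
  count and still forces \<open>k\<close> close to \<open>n / 2\<close>; the loss of a factor \<open>n\<close> is made up by
  stretching copies one step further.
\<close>
definition central_size :: "nat \<Rightarrow> nat \<Rightarrow> bool" where
  "central_size n k \<longleftrightarrow> k \<le> n \<and> n choose (n div 2) \<le> (n + 1) * (n choose k)"

lemma card_not_central_size_le:
  "card {A. A \<subseteq> {1..n} \<and> \<not> central_size n (card A)} \<le> n choose (n div 2)"
proof -
  define K where "K = {k. k \<le> n \<and> \<not> central_size n k}"
  have fin: "finite K" by (simp add: K_def)
  have sub: "{A. A \<subseteq> {1..n} \<and> \<not> central_size n (card A)} \<subseteq> (\<Union>k\<in>K. {A. A \<subseteq> {1..n} \<and> card A = k})"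
    using card_mono[of "{1..n}"] by (fastforce simp: K_def)
  have "card {A. A \<subseteq> {1..n} \<and> \<not> central_size n (card A)} \<le> card (\<Union>k\<in>K. {A. A \<subseteq> {1..n} \<and> card A = k})"
    using fin by (intro card_mono[OF _ sub]) auto
  also have "\<dots> \<le> (\<Sum>k\<in>K. card {A. A \<subseteq> {1..n} \<and> card A = k})" by (rule card_UN_le[OF fin])
  also have "\<dots> = (\<Sum>k\<in>K. n choose k)" using n_subsets[of "{1..n}"] by simp
  finally have "(n + 1) * card {A. A \<subseteq> {1..n} \<and> \<not> central_size n (card A)} \<le> (n + 1) * (\<Sum>k\<in>K. n choose k)"
    by (rule mult_le_mono2)
  also have "\<dots> = (\<Sum>k\<in>K. (n + 1) * (n choose k))" by (rule sum_distrib_left)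
  also have "\<dots> \<le> (\<Sum>k\<in>K. n choose (n div 2))"
    by (intro sum_mono) (auto simp: K_def central_size_def)
  also have "\<dots> \<le> (n + 1) * (n choose (n div 2))"
  proof -
    have "card K \<le> card {..n}" by (intro card_mono) (auto simp: K_def)
    then show ?thesis by (simp add: mult_le_mono1 del: mult_Suc)
  qed
  finally show ?thesis by (metis Suc_eq_plus1 Suc_mult_le_cancel1)
qed

text \<open>
  The number \<open>r\<close> stands for \<open>\<surd>d\<close> rounded up. A uniformly random pair of an offset and a
  permutation gives the random grid; instead of probabilities, the statements below count pairs.
\<close>
locale random_grid =
  fixes n m d r :: nat
  assumes d: "d \<ge> 1" and m: "m \<ge> 1" and r: "1 \<le> r" "r \<le> d" "d \<le> r\<^sup>2" and n: "16 * (d * m) \<le> n"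
    and central_near: "\<And>k. central_size n k \<Longrightarrow> \<bar>2 * real k - real n\<bar> \<le> real m"
begin

definition offsets :: "nat set" where
  "offsets = {q \<in> {..n}. \<bar>2 * real q - (real n - real d * (real m + 1))\<bar> \<le> real (3 * r * m)}"

definition perms :: "(nat \<Rightarrow> nat) set" where
  "perms = {p. p permutes {1..n}}"

definition preimages :: "nat \<Rightarrow> (nat \<times> (nat \<Rightarrow> nat)) set" where
  "preimages k = {(q, x) \<in> offsets \<times> grid m d. q + (\<Sum>i\<in>{1..d}. x i) = k}"

definition trace :: "nat set set \<Rightarrow> nat \<Rightarrow> (nat \<Rightarrow> nat) \<Rightarrow> (nat \<Rightarrow> nat) set" where
  "trace F q p = {x \<in> grid m d. p ` grid_set n m d q x \<in> F}"

lemma dm: "d * m \<le> n" "real (16 * (d * m)) \<le> real n" "m \<le> d * m" "r * m \<le> d * m"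
proof -
  show "d * m \<le> n" using n by linarith
  show "real (16 * (d * m)) \<le> real n" using n by (simp only: of_nat_le_iff)
  show "m \<le> d * m" "r * m \<le> d * m" using d m r by auto
qed

lemma finite_offsets [simp]: "finite offsets" by (simp add: offsets_def)

lemma finite_perms [simp]: "finite perms" by (simp add: perms_def finite_permutations)

lemma card_perms: "card perms = fact n" by (simp add: perms_def card_permutations)

lemma card_offsets: "card offsets \<le> 4 * r * m"
proof (cases "offsets = {}")
  case False
  define l where "l = Min offsets"
  have l: "l \<in> offsets" "\<And>q. q \<in> offsets \<Longrightarrow> l \<le> q" using False by (auto simp: l_def)
  have "q \<le> l + 3 * r * m" if "q \<in> offsets" for q
  proof -
    have "real q \<le> real l + real (3 * r * m)"
      using that l(1) unfolding offsets_def abs_le_iff mem_Collect_eq by linarith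
    then show ?thesis by linarith
  qed
  then have "offsets \<subseteq> {l..l + 3 * r * m}" using l by auto
  then have "card offsets \<le> card {l..l + 3 * r * m}" by (intro card_mono) auto
  moreover have "1 \<le> r * m" using r m by simp
  ultimately show ?thesis by (simp add: mult.assoc del: One_nat_def)
qed simp

lemma offset_le:
  assumes "q \<in> offsets"
  shows "q \<le> n - d * m"
proof -
  have "2 * real q \<le> real n - real (d * m) - real d + 3 * real (r * m)"
    using assms by (simp add: offsets_def abs_le_iff algebra_simps)
  moreover have "real (r * m) \<le> real (d * m)" using dm(4) by (simp only: of_nat_le_iff)
  ultimately have "real q \<le> real n - real (d * m)" using dm(2) by simp
  then show ?thesis using dm(1) by (simp flip: of_nat_diff of_nat_mult)
qed

lemma central_size_bounds:
  assumes "central_size n k"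
  shows "k \<le> n" "2 * (d * m) \<le> k" "2 * (d * m) \<le> n - k" "n \<le> 4 * k"
proof -
  show k: "k \<le> n" using assms by (simp add: central_size_def)
  have "real m \<le> real (d * m)" using dm(3) by (simp only: of_nat_le_iff)
  then have "2 * real (d * m) \<le> real k" "2 * real (d * m) \<le> real n - real k" "real n \<le> 4 * real k"
    using central_near[OF assms] dm(2) by (auto simp: abs_le_iff)
  then show "2 * (d * m) \<le> k" "2 * (d * m) \<le> n - k" "n \<le> 4 * k" using k by linarith+
qed

lemma finite_preimages [simp]: "finite (preimages k)"
  by (rule finite_subset[of _ "offsets \<times> grid m d"]) (auto simp: preimages_def)

lemma card_preimages_le: "card (preimages k) \<le> m ^ d"
proof -
  have "inj_on snd (preimages k)" by (auto simp: inj_on_def preimages_def)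
  then have "card (preimages k) \<le> card (grid m d)"
    by (rule card_inj_on_le) (auto simp: preimages_def)
  then show ?thesis by simp
qed

text \<open>
  For at least three quarters of the grid points, the offset that completes the size to \<open>k\<close> lies in
  the window. This is where the window width \<open>\<surd>d m\<close>, rather than \<open>d m\<close>, suffices.
\<close>
lemma card_preimages_ge:
  assumes "central_size n k"
  shows "3 * m ^ d \<le> 4 * card (preimages k)"
proof -
  define B where "B = {x \<in> grid m d. 2 * real r * real m
      \<le> \<bar>2 * real (\<Sum>i\<in>{1..d}. x i) - real d * (real m + 1)\<bar>}"
  define h where "h x = (k - (\<Sum>i\<in>{1..d}. x i), x)" for x :: "nat \<Rightarrow> nat"
  have "h ` (grid m d - B) \<subseteq> preimages k"
  proof (intro image_subsetI)
    fix x assume x: "x \<in> grid m d - B"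
    define z where "z = (\<Sum>i\<in>{1..d}. x i)"
    have "z \<le> d * m" using sum_grid_coords_le[of x m d "\<lambda>_. 0"] x by (simp add: z_def)
    then have zk: "z \<le> k" using central_size_bounds[OF assms] by linarith
    have "\<bar>2 * real z - real d * (real m + 1)\<bar> < 2 * real r * real m"
      using x by (auto simp: B_def z_def)
    moreover have "\<bar>2 * real k - real n\<bar> \<le> real (r * m)"
    proof -
      have "m \<le> r * m" using r by simp
      then have "real m \<le> real (r * m)" by (simp only: of_nat_le_iff)
      then show ?thesis using central_near[OF assms] by linarith
    qed
    ultimately have "k - z \<in> offsets"
      using zk central_size_bounds(1)[OF assms]
      by (auto simp: offsets_def of_nat_diff abs_if algebra_simps split: if_splits)
    then show "h x \<in> preimages k"
      using zk x unfolding h_def preimages_def z_def[symmetric] by simp (simp add: z_def)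
  qed
  moreover have "inj_on h (grid m d - B)" by (auto simp: h_def inj_on_def)
  ultimately have "card (grid m d - B) \<le> card (preimages k)" by (meson card_inj_on_le finite_preimages)
  moreover have "card (grid m d - B) = m ^ d - card B"
    by (subst card_Diff_subset) (auto simp: B_def)
  moreover have "4 * card B \<le> m ^ d"
    using card_grid_far_from_centre[OF m r(3) r(1)] unfolding B_def grid_def
    by (metis (no_types, lifting) of_nat_le_iff of_nat_mult of_nat_numeral of_nat_power)
  ultimately show ?thesis by linarith
qed

lemma fact_mult_le:
  assumes "central_size n k"
  shows "fact n \<le> fact k * fact (n - k) * (n choose (n div 2))"
    "fact k * fact (n - k) * (n choose (n div 2)) \<le> (n + 1) * (fact n :: nat)"
proof -
  have eq: "fact k * fact (n - k) * (n choose k) = (fact n :: nat)"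
    using assms by (simp add: binomial_fact_lemma central_size_def)
  show "fact n \<le> fact k * fact (n - k) * (n choose (n div 2))"
    unfolding eq[symmetric] by (intro mult_le_mono2 binomial_maximum)
  have "fact k * fact (n - k) * (n choose (n div 2)) \<le> fact k * fact (n - k) * ((n + 1) * (n choose k))"
    using assms by (intro mult_le_mono2) (simp add: central_size_def)
  also have "\<dots> = (n + 1) * fact n" unfolding eq[symmetric] by (simp only: mult_ac)
  finally show "fact k * fact (n - k) * (n choose (n div 2)) \<le> (n + 1) * (fact n :: nat)" .
qed

text \<open>
  The expected number of members of \<open>F\<close> in a random grid, from below: sum over the members, and for
  each of them over its possible preimages.
\<close>
lemma sum_card_trace_ge:
  assumes F: "F \<subseteq> Pow {1..n}" "\<And>A. A \<in> F \<Longrightarrow> central_size n (card A)"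
  shows "3 * m ^ d * fact n * card F
    \<le> 4 * (n choose (n div 2)) * (\<Sum>q\<in>offsets. \<Sum>p\<in>perms. card (trace F q p))"
proof -
  define M where "M = n choose (n div 2)"
  define hit :: "nat set \<Rightarrow> nat \<Rightarrow> (nat \<Rightarrow> nat) \<Rightarrow> (nat \<Rightarrow> nat) \<Rightarrow> nat"
    where "hit A q p x = of_bool (p ` grid_set n m d q x = A)" for A q p x
  have finF: "finite F" using F(1) by (rule finite_subset) simp
  have "(\<Sum>q\<in>offsets. \<Sum>p\<in>perms. card (trace F q p))
      = (\<Sum>q\<in>offsets. \<Sum>p\<in>perms. \<Sum>x\<in>grid m d. \<Sum>A\<in>F. hit A q p x)"
  proof (intro sum.cong refl)
    fix q p
    have "(\<Sum>A\<in>F. hit A q p x) = of_bool (p ` grid_set n m d q x \<in> F)" for x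
      unfolding hit_def of_bool_def using sum.delta'[OF finF, of "p ` grid_set n m d q x" "\<lambda>_. 1 :: nat"] by simp
    then show "card (trace F q p) = (\<Sum>x\<in>grid m d. \<Sum>A\<in>F. hit A q p x)"
      by (simp add: trace_def Int_def)
  qed
  also have "\<dots> = (\<Sum>q\<in>offsets. \<Sum>x\<in>grid m d. \<Sum>p\<in>perms. \<Sum>A\<in>F. hit A q p x)"
    by (intro sum.cong refl sum.swap)
  also have "\<dots> = (\<Sum>q\<in>offsets. \<Sum>x\<in>grid m d. \<Sum>A\<in>F. \<Sum>p\<in>perms. hit A q p x)"
    by (intro sum.cong refl sum.swap)
  also have "\<dots> = (\<Sum>(q, x)\<in>offsets \<times> grid m d. \<Sum>A\<in>F. \<Sum>p\<in>perms. hit A q p x)"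
    by (rule sum.cartesian_product)
  also have "\<dots> = (\<Sum>A\<in>F. \<Sum>(q, x)\<in>offsets \<times> grid m d. \<Sum>p\<in>perms. hit A q p x)"
    unfolding case_prod_beta by (rule sum.swap)
  finally have eq: "(\<Sum>q\<in>offsets. \<Sum>p\<in>perms. card (trace F q p))
     = (\<Sum>A\<in>F. \<Sum>(q, x)\<in>offsets \<times> grid m d. \<Sum>p\<in>perms. hit A q p x)" .
  have A: "3 * m ^ d * fact n \<le> 4 * M * (\<Sum>(q, x)\<in>offsets \<times> grid m d. \<Sum>p\<in>perms. hit A q p x)" if A: "A \<in> F" for A
  proof -
    define k where "k = card A"
    have k: "central_size n k" using F(2)[OF A] by (simp add: k_def)
    have "card (preimages k) * (fact k * fact (n - k)) = (\<Sum>(q, x)\<in>preimages k. fact k * fact (n - k))"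
      by simp
    also have "\<dots> = (\<Sum>(q, x)\<in>preimages k. \<Sum>p\<in>perms. hit A q p x)"
    proof (intro sum.cong refl, clarify)
      fix q x assume "(q, x) \<in> preimages k"
      then have qx: "q \<in> offsets" "x \<in> grid m d" "q + (\<Sum>i\<in>{1..d}. x i) = k"
        by (auto simp: preimages_def)
      have "card (grid_set n m d q x) = k"
        using card_grid_set[OF offset_le[OF qx(1)] qx(2)] qx(3) by simp
      then have "card {p. p permutes {1..n} \<and> p ` grid_set n m d q x = A} = fact k * fact (n - k)"
        using card_permutes_image_eq[of "{1..n}" "grid_set n m d q x" A]
          grid_set_subset[OF dm(1) offset_le[OF qx(1)] qx(2)] A F(1) by (simp add: k_def subset_iff)
      moreover have "perms \<inter> {p. p ` grid_set n m d q x = A} = {p. p permutes {1..n} \<and> p ` grid_set n m d q x = A}"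
        by (auto simp: perms_def)
      ultimately show "fact k * fact (n - k) = (\<Sum>p\<in>perms. hit A q p x)"
        by (simp add: hit_def)
    qed
    also have "\<dots> \<le> (\<Sum>(q, x)\<in>offsets \<times> grid m d. \<Sum>p\<in>perms. hit A q p x)"
      by (intro sum_mono2) (auto simp: preimages_def)
    finally have 1: "card (preimages k) * (fact k * fact (n - k)) \<le> \<dots>" .
    have "3 * m ^ d * fact n \<le> 4 * card (preimages k) * (fact k * fact (n - k) * M)"
      unfolding M_def by (intro mult_le_mono card_preimages_ge[OF k] fact_mult_le(1)[OF k])
    also have "\<dots> = 4 * M * (card (preimages k) * (fact k * fact (n - k)))" by (simp add: mult_ac)
    finally show ?thesis using 1 by (meson le_trans mult_le_mono2)
  qed
  have "3 * m ^ d * fact n * card F = (\<Sum>A\<in>F. 3 * m ^ d * fact n)" by simp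
  also have "\<dots> \<le> (\<Sum>A\<in>F. 4 * M * (\<Sum>(q, x)\<in>offsets \<times> grid m d. \<Sum>p\<in>perms. hit A q p x))"
    by (intro sum_mono A)
  also have "\<dots> = 4 * M * (\<Sum>q\<in>offsets. \<Sum>p\<in>perms. card (trace F q p))"
    unfolding eq by (rule sum_distrib_left[symmetric])
  finally show ?thesis by (simp add: M_def)
qed

text \<open>
  Every far tip of the trace comes from a copy \<open>X\<close> in \<open>F\<close> together with its member \<open>A\<close> at the tip. For
  fixed \<open>X\<close> and \<open>A\<close>, any second member \<open>B\<close> of \<open>X\<close> is far behind, so few grids show the pair.
\<close>
lemma sum_card_far_tips_le:
  assumes F: "F \<subseteq> Pow {1..n}" "\<And>A. A \<in> F \<Longrightarrow> central_size n (card A)"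
    and P: "finite P" "card P \<ge> 2"
    and c: "c > 0" "\<And>a k. s \<le> a \<Longrightarrow> 2 * a \<le> k \<Longrightarrow> real (a + 1) ^ d * real k ^ s \<le> c * real (k choose a)"
    and c': "c' > 0" "\<And>a k. 2 * a \<le> k \<Longrightarrow> real (a + 1) ^ d \<le> c' * real (k choose a)"
  shows "real (\<Sum>q\<in>offsets. \<Sum>p\<in>perms. card (far_tips P rel m d s (trace F q p)))
      * (real n ^ s * real (n choose (n div 2)))
    \<le> real (card (induced_copies_in P rel (Pow {1..n}) (cube_order n) F)) * real (card P)
      * (4 ^ s * real m ^ d * (c * c') * (real (n + 1) * fact n))"
proof -
  define M where "M = n choose (n div 2)"
  define Cop where "Cop = induced_copies_in P rel (Pow {1..n}) (cube_order n) F"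
  define tips where "tips = (\<lambda>(q, p). far_tips P rel m d s (trace F q p))"
  \<comment> \<open>The grids, with a marked point \<open>x\<close>, that show \<open>X\<close> as a stretched copy with \<open>A\<close> at its tip \<open>x\<close>.\<close>
  define E where "E X A = {((q, p), x). q \<in> offsets \<and> p \<in> perms \<and> x \<in> grid m d \<and>
      p ` grid_set n m d q x = A \<and>
      (\<forall>B\<in>X - {A}. \<exists>y\<in>grid m d. y 1 + s \<le> x 1 \<and> p ` grid_set n m d q y = B)}" for X A
  define U where "U = 4 ^ s * real m ^ d * (c * c') * (real (n + 1) * fact n)"
  have finF: "finite F" using F(1) by (rule finite_subset) simp
  have "Cop \<subseteq> Pow F" by (auto simp: Cop_def induced_copies_in_def)
  then have finC: "finite Cop" using finF by (simp add: finite_subset)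
  have copX: "X \<subseteq> F" "card X = card P" "finite X" if "X \<in> Cop" for X
    using that P by (auto simp: Cop_def induced_copies_in_def induced_copies_def card_image)
  have finE: "finite (E X A)" for X A
    by (rule finite_subset[of _ "(offsets \<times> perms) \<times> grid m d"]) (auto simp: E_def)
  have "(SIGMA i:offsets \<times> perms. tips i) \<subseteq> (\<Union>X\<in>Cop. \<Union>A\<in>X. E X A)"
  proof
    fix z assume "z \<in> (SIGMA i:offsets \<times> perms. tips i)"
    then obtain q p x where z: "z = ((q, p), x)" and qp: "q \<in> offsets" "p \<in> perms"
      and x: "x \<in> far_tips P rel m d s (trace F q p)"
      by (auto simp: tips_def)
    obtain X where X: "X \<in> induced_copies_in P rel (grid m d) (grid_order m d) (trace F q p)"
      and xX: "x \<in> X" "\<And>y. y \<in> X - {x} \<Longrightarrow> y 1 + s \<le> x 1"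
      using x by (auto simp: far_tips_def)
    define S where "S = (\<lambda>x. p ` grid_set n m d q x)"
    have SX: "S ` X \<in> Cop" unfolding S_def Cop_def
      using qp X by (intro image_grid_set_copy[OF _ dm(1) offset_le[OF qp(1)] X]) (auto simp: perms_def trace_def)
    have XG: "X \<subseteq> grid m d" using X by (auto simp: induced_copies_in_def trace_def)
    have "\<exists>y\<in>grid m d. y 1 + s \<le> x 1 \<and> S y = B" if "B \<in> S ` X - {S x}" for B
      using that xX XG by auto
    then have "((q, p), x) \<in> E (S ` X) (S x)"
      using qp xX XG by (auto simp: E_def S_def)
    then show "z \<in> (\<Union>X\<in>Cop. \<Union>A\<in>X. E X A)" using SX xX z by blast
  qed
  then have "card (SIGMA i:offsets \<times> perms. tips i) \<le> card (\<Union>X\<in>Cop. \<Union>A\<in>X. E X A)"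
    using finC copX finE by (intro card_mono finite_UN_I) auto
  also have "\<dots> \<le> (\<Sum>X\<in>Cop. card (\<Union>A\<in>X. E X A))" by (rule card_UN_le[OF finC])
  also have "\<dots> \<le> (\<Sum>X\<in>Cop. \<Sum>A\<in>X. card (E X A))" by (intro sum_mono card_UN_le copX)
  finally have le: "card (SIGMA i:offsets \<times> perms. tips i) \<le> \<dots>" .
  have fint: "finite (tips i)" for i
    by (rule finite_subset[of _ "grid m d"]) (auto simp: tips_def far_tips_def trace_def)
  have "card (SIGMA i:offsets \<times> perms. tips i)
      = (\<Sum>q\<in>offsets. \<Sum>p\<in>perms. card (far_tips P rel m d s (trace F q p)))"
    using fint by (simp add: card_SigmaI sum.cartesian_product case_prod_beta tips_def)
  with le have le: "(\<Sum>q\<in>offsets. \<Sum>p\<in>perms. card (far_tips P rel m d s (trace F q p)))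
      \<le> (\<Sum>X\<in>Cop. \<Sum>A\<in>X. card (E X A))" by simp
  have EXA: "real (card (E X A)) * (real n ^ s * real M) \<le> U" if X: "X \<in> Cop" "A \<in> X" for X A
  proof -
    define k where "k = card A"
    have k: "central_size n k" using F(2) copX(1)[OF X(1)] X(2) by (auto simp: k_def)
    note kb = central_size_bounds[OF k]
    have "card X \<noteq> 1" using copX(2)[OF X(1)] P(2) by simp
    then have "X \<noteq> {A}" by auto
    then obtain B where B: "B \<in> X - {A}" using X(2) by blast
    define H where "H = (\<lambda>(q, x). {p. p permutes {1..n} \<and> p ` grid_set n m d q x = A \<and>
     (\<exists>y\<in>grid m d. y 1 + s \<le> x 1 \<and> p ` grid_set n m d q y = B)})"
    define g :: "(nat \<times> (nat \<Rightarrow> nat)) \<times> (nat \<Rightarrow> nat) \<Rightarrow> (nat \<times> (nat \<Rightarrow> nat)) \<times> (nat \<Rightarrow> nat)"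
      where "g = (\<lambda>((q, p), x). ((q, x), p))"
    have "inj_on g (E X A)" by (auto simp: g_def inj_on_def)
    moreover have "g ` E X A \<subseteq> (SIGMA i:preimages k. H i)"
    proof (intro image_subsetI)
      fix z assume zE: "z \<in> E X A"
      obtain q p x where z: "z = ((q, p), x)" by (metis surj_pair)
      have e: "q \<in> offsets" "p \<in> perms" "x \<in> grid m d" "p ` grid_set n m d q x = A"
        "\<exists>y\<in>grid m d. y 1 + s \<le> x 1 \<and> p ` grid_set n m d q y = B"
        using zE B unfolding E_def z by simp_all
      have "inj p" using e(2) by (auto simp: perms_def permutes_inj)
      then have "k = card (grid_set n m d q x)" using e(4) by (auto simp: k_def card_image inj_on_subset)
      then have "q + (\<Sum>i\<in>{1..d}. x i) = k" using card_grid_set[OF offset_le[OF e(1)] e(3)] by simp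
      then show "g z \<in> (SIGMA i:preimages k. H i)"
        using e z by (auto simp: g_def H_def preimages_def perms_def)
    qed
    moreover have finH: "finite (H i)" for i
      by (rule finite_subset[OF _ finite_perms]) (auto simp: H_def perms_def)
    ultimately have "card (E X A) \<le> card (SIGMA i:preimages k. H i)"
      by (intro card_inj_on_le[of g]) (auto intro: finite_SigmaI)
    also have "\<dots> = (\<Sum>i\<in>preimages k. card (H i))" using finH by (simp add: card_SigmaI)
    finally have EH: "real (card (E X A)) \<le> (\<Sum>i\<in>preimages k. real (card (H i)))"
      by (metis of_nat_le_iff of_nat_sum)
    have "real (card (E X A)) * real k ^ s \<le> (\<Sum>i\<in>preimages k. real (card (H i)) * real k ^ s)"
      using EH by (simp add: mult_right_mono flip: sum_distrib_right)
    also have "\<dots> \<le> (\<Sum>i\<in>preimages k. c * c' * (fact k * fact (n - k)))"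
    proof (intro sum_mono)
      fix i assume "i \<in> preimages k"
      then obtain q x where i: "i = (q, x)" "q \<in> offsets" "x \<in> grid m d" "q + (\<Sum>i\<in>{1..d}. x i) = k"
        by (auto simp: preimages_def)
      show "real (card (H i)) * real k ^ s \<le> c * c' * (fact k * fact (n - k))"
        unfolding i H_def case_prod_conv
        by (rule far_pair_count[OF c c' d dm(1) offset_le[OF i(2)] i(3,4) kb(2,3,1)])
    qed
    also have "\<dots> \<le> real m ^ d * (c * c' * (fact k * fact (n - k)))"
    proof -
      have "real (card (preimages k)) \<le> real (m ^ d)" using card_preimages_le by (simp only: of_nat_le_iff)
      then show ?thesis using c(1) c'(1) by (simp add: mult_right_mono)
    qed
    finally have Ek: "real (card (E X A)) * real k ^ s \<le> real m ^ d * (c * c' * (fact k * fact (n - k)))" .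
    have "real n ^ s \<le> (4 * real k) ^ s" using kb(4) by (intro power_mono) (auto simp flip: of_nat_le_iff)
    then have "real (card (E X A)) * (real n ^ s * real M) \<le> real (card (E X A)) * ((4 * real k) ^ s * real M)"
      by (intro mult_left_mono mult_right_mono) auto
    also have "\<dots> = 4 ^ s * real M * (real (card (E X A)) * real k ^ s)"
      by (simp add: power_mult_distrib mult_ac)
    also have "\<dots> \<le> 4 ^ s * real M * (real m ^ d * (c * c' * (fact k * fact (n - k))))"
      by (intro mult_left_mono Ek) auto
    also have "\<dots> = 4 ^ s * real m ^ d * (c * c') * real (fact k * fact (n - k) * M)"
      by (simp add: mult_ac)
    also have "\<dots> \<le> 4 ^ s * real m ^ d * (c * c') * real ((n + 1) * fact n)"
      using c(1) c'(1) fact_mult_le(2)[OF k] unfolding M_def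
      by (intro mult_left_mono) (simp_all only: of_nat_le_iff, simp)
    also have "\<dots> = U" unfolding U_def of_nat_mult of_nat_fact ..
    finally show ?thesis .
  qed
  have "real (\<Sum>q\<in>offsets. \<Sum>p\<in>perms. card (far_tips P rel m d s (trace F q p))) * (real n ^ s * real M)
     \<le> real (\<Sum>X\<in>Cop. \<Sum>A\<in>X. card (E X A)) * (real n ^ s * real M)"
    using le by (intro mult_right_mono) (simp_all only: of_nat_le_iff, simp)
  also have "\<dots> = (\<Sum>X\<in>Cop. \<Sum>A\<in>X. real (card (E X A)) * (real n ^ s * real M))"
    by (simp add: sum_distrib_right)
  also have "\<dots> \<le> (\<Sum>X\<in>Cop. \<Sum>A\<in>X. U)" by (intro sum_mono EXA)
  also have "\<dots> = real (card Cop) * real (card P) * U" using copX by simp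
  finally show ?thesis by (simp add: M_def U_def Cop_def)
qed

end


section \<open>Counting copies\<close>

lemma card_induced_copies_in_mono:
  assumes "F' \<subseteq> F" "finite F"
  shows "card (induced_copies_in P r Q s F') \<le> card (induced_copies_in P r Q s F)"
proof (rule card_mono)
  show "finite (induced_copies_in P r Q s F)"
    by (rule finite_subset[of _ "Pow F"]) (use assms in \<open>auto simp: induced_copies_in_def\<close>)
qed (use assms in \<open>auto simp: induced_copies_in_def\<close>)

lemma obtain_ceiling_sqrt:
  assumes "d \<ge> (1::nat)"
  obtains r :: nat where "1 \<le> r" "r \<le> d" "d \<le> r\<^sup>2" "real r \<le> 2 * sqrt (real d)"
proof (rule that[of "nat \<lceil>sqrt (real d)\<rceil>"])
  have s1: "1 \<le> sqrt (real d)" using assms by simp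
  have sd: "sqrt (real d) \<le> real d" using assms by (intro real_le_lsqrt) (auto simp: power2_eq_square)
  have eq: "real (nat \<lceil>sqrt (real d)\<rceil>) = of_int \<lceil>sqrt (real d)\<rceil>" using s1 by simp
  show "1 \<le> nat \<lceil>sqrt (real d)\<rceil>" using s1 by linarith
  show "nat \<lceil>sqrt (real d)\<rceil> \<le> d" using sd by (simp add: ceiling_le)
  have "real d = (sqrt (real d))\<^sup>2" by simp
  also have "\<dots> \<le> (real (nat \<lceil>sqrt (real d)\<rceil>))\<^sup>2" unfolding eq by (intro power_mono) auto
  finally show "d \<le> (nat \<lceil>sqrt (real d)\<rceil>)\<^sup>2" by (metis of_nat_le_iff of_nat_power)
  show "real (nat \<lceil>sqrt (real d)\<rceil>) \<le> 2 * sqrt (real d)" unfolding eq using s1 by linarith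
qed

text \<open>
  The lower and upper bounds for the total number of far tips over all grids, combined. The constant
  40 is chosen such that \<open>3 (t + 40 \<surd>d C - 1)\<close> exceeds \<open>32 \<surd>d (C + s + 2)\<close>. The
  factor 32 is 4 times the bound 8 for the number of offsets in units of \<open>\<surd>d m\<close>, and the second term
  counts the points that the grids can hold without far tips.
\<close>
lemma (in random_grid) card_copies_ge:
  assumes F: "F \<subseteq> Pow {1..n}" and P: "finite P" "card P \<ge> 2"
    and ex: "real (ex_star m d P rel) \<le> C * real m ^ (d - 1)" and C: "C \<ge> 1"
    and r2: "real r \<le> 2 * sqrt (real d)"
    and t: "40 * sqrt (real d) * real s \<le> t"
    and big: "(t + 40 * sqrt (real d) * C + \<epsilon>) * real (n choose (n div 2)) \<le> real (card F)"
    and c: "c > 0" "\<And>a k. s + 2 \<le> a \<Longrightarrow> 2 * a \<le> k \<Longrightarrow> real (a + 1) ^ d * real k ^ (s + 2) \<le> c * real (k choose a)"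
    and c': "c' > 0" "\<And>a k. 2 * a \<le> k \<Longrightarrow> real (a + 1) ^ d \<le> c' * real (k choose a)"
    and n2: "real (card P) * 4 ^ (s + 3) * (c * c') * real (n + 1) \<le> real n ^ 2"
  shows "\<epsilon> * real n ^ s * real (n choose (n div 2))
    \<le> real (card (induced_copies_in P rel (Pow {1..n}) (cube_order n) F))"
proof -
  define M where "M = real (n choose (n div 2))"
  define F1 where "F1 = {A \<in> F. central_size n (card A)}"
  define cop where "cop = real (card (induced_copies_in P rel (Pow {1..n}) (cube_order n) F1))"
  define tips where "tips = real (\<Sum>q\<in>offsets. \<Sum>p\<in>perms. card (far_tips P rel m d (s + 2) (trace F1 q p)))"
  define sd where "sd = sqrt (real d)"
  have finF: "finite F" using F by (rule finite_subset) simp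
  have F1: "F1 \<subseteq> Pow {1..n}" "\<And>A. A \<in> F1 \<Longrightarrow> central_size n (card A)"
    using F by (auto simp: F1_def)
  have Mpos: "M > 0" by (simp add: M_def)
  have sd1: "1 \<le> sd" using d by (simp add: sd_def)
  have npos: "n > 0" using dm(1,3) m by linarith
  \<comment> \<open>Sets of non-central size cost only one central binomial coefficient.\<close>
  have "F \<subseteq> F1 \<union> {A. A \<subseteq> {1..n} \<and> \<not> central_size n (card A)}" using F by (auto simp: F1_def)
  then have "card F \<le> card (F1 \<union> {A. A \<subseteq> {1..n} \<and> \<not> central_size n (card A)})"
    using finF by (intro card_mono) (auto simp: F1_def)
  also have "\<dots> \<le> card F1 + card {A. A \<subseteq> {1..n} \<and> \<not> central_size n (card A)}" by (rule card_Un_le)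
  also have "\<dots> \<le> card F1 + (n choose (n div 2))" using card_not_central_size_le[of n] by simp
  finally have "real (card F) \<le> real (card F1 + (n choose (n div 2)))" by (simp only: of_nat_le_iff)
  then have cF1: "(t + 40 * sd * C + \<epsilon> - 1) * M \<le> real (card F1)"
    using big by (simp add: M_def sd_def algebra_simps)
  have md: "real m ^ (d - 1) * real m = real m ^ d" using d by (cases d) auto
  have "real (card (trace F1 q p)) \<le> real (card (far_tips P rel m d (s + 2) (trace F1 q p)))
      + (C + real (s + 2)) * real m ^ (d - 1)" for q p
  proof -
    have "card (trace F1 q p) \<le> card (far_tips P rel m d (s + 2) (trace F1 q p))
        + ex_star m d P rel + (s + 2) * m ^ (d - 1)"
      using P d by (intro card_le_far_tips) (auto simp: trace_def)
    then have "real (card (trace F1 q p)) \<le> real (card (far_tips P rel m d (s + 2) (trace F1 q p))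
        + ex_star m d P rel + (s + 2) * m ^ (d - 1))" by (simp only: of_nat_le_iff)
    then show ?thesis using ex by (simp add: algebra_simps)
  qed
  then have "real (\<Sum>q\<in>offsets. \<Sum>p\<in>perms. card (trace F1 q p))
     \<le> (\<Sum>q\<in>offsets. \<Sum>p\<in>perms. real (card (far_tips P rel m d (s + 2) (trace F1 q p)))
        + (C + real (s + 2)) * real m ^ (d - 1))"
    unfolding of_nat_sum by (intro sum_mono) simp
  also have "\<dots> = tips + real (card offsets) * (fact n * ((C + real (s + 2)) * real m ^ (d - 1)))"
    by (simp add: tips_def sum.distrib card_perms)
  also have "\<dots> \<le> tips + (8 * sd * real m) * (fact n * ((C + real (s + 2)) * real m ^ (d - 1)))"
  proof -
    have "real (card offsets) \<le> real (4 * r * m)" using card_offsets by (simp only: of_nat_le_iff)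
    also have "\<dots> \<le> 8 * sd * real m" using r2 by (simp add: sd_def mult_right_mono)
    finally show ?thesis using C by (intro add_left_mono mult_right_mono) auto
  qed
  also have "\<dots> = tips + 8 * sd * (C + real s + 2) * (real m ^ d * fact n)"
    unfolding md[symmetric] by (simp add: algebra_simps)
  finally have up: "real (\<Sum>q\<in>offsets. \<Sum>p\<in>perms. card (trace F1 q p)) \<le> \<dots>" .
  \<comment> \<open>Up to \<open>M\<close>, \<open>w\<close> is the common scale of the bounds: grid points times permutations.\<close>
  define w where "w = real m ^ d * fact n"
  have wpos: "w > 0" using m by (simp add: w_def)
  have "3 * w * ((t + 40 * sd * C + \<epsilon> - 1) * M) \<le> 3 * w * real (card F1)"
    using wpos by (intro mult_left_mono cF1) auto
  also have "\<dots> = real (3 * m ^ d * fact n * card F1)" by (simp add: w_def)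
  also have "\<dots> \<le> real (4 * (n choose (n div 2)) * (\<Sum>q\<in>offsets. \<Sum>p\<in>perms. card (trace F1 q p)))"
    using sum_card_trace_ge[OF F1] by (simp only: of_nat_le_iff)
  also have "\<dots> = 4 * M * real (\<Sum>q\<in>offsets. \<Sum>p\<in>perms. card (trace F1 q p))" by (simp add: M_def)
  also have "\<dots> \<le> 4 * M * (tips + 8 * sd * (C + real s + 2) * w)"
    using Mpos up by (intro mult_left_mono) (auto simp: w_def)
  finally have "M * (3 * w * (t + 40 * sd * C + \<epsilon> - 1)) \<le> M * (4 * (tips + 8 * sd * (C + real s + 2) * w))"
    by (simp add: mult_ac)
  then have "3 * w * (t + 40 * sd * C + \<epsilon> - 1) \<le> 4 * (tips + 8 * sd * (C + real s + 2) * w)"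
    using Mpos by simp
  then have key: "w * (3 * (t + 40 * sd * C + \<epsilon> - 1) - 32 * sd * (C + real s + 2)) \<le> 4 * tips"
    by (simp add: algebra_simps)
  have "3 * \<epsilon> \<le> 3 * (t + 40 * sd * C + \<epsilon> - 1) - 32 * sd * (C + real s + 2)"
  proof -
    have "sd \<le> sd * C" using sd1 C by simp
    moreover have "0 \<le> sd * real s" using sd1 by simp
    moreover have "40 * (sd * real s) \<le> t" using t by (simp add: sd_def mult.assoc)
    moreover have "40 * sd * C = 40 * (sd * C)"
      "32 * sd * (C + real s + 2) = 32 * (sd * C) + 32 * (sd * real s) + 64 * sd"
      by (simp_all add: algebra_simps)
    moreover have "3 * \<epsilon> \<le> 3 * (t + a + \<epsilon> - 1) - b"
      if "sd \<le> u" "0 \<le> v" "40 * v \<le> t" "a = 40 * u" "b = 32 * u + 32 * v + 64 * sd" for a b u v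
      using that sd1 by simp
    ultimately show ?thesis by blast
  qed
  then have tips_ge: "w * (3 * \<epsilon>) \<le> 4 * tips"
    using key wpos by (meson mult_left_mono less_imp_le order_trans)
  have "tips * (real n ^ (s + 2) * M) \<le> cop * real (card P) * (4 ^ (s + 2) * real m ^ d * (c * c') * (real (n + 1) * fact n))"
    unfolding tips_def M_def cop_def by (rule sum_card_far_tips_le[OF F1 P c c'])
  also have "\<dots> = w * cop * (real (card P) * 4 ^ (s + 2) * (c * c') * real (n + 1))"
    by (simp add: w_def mult_ac)
  finally have "4 * tips * (real n ^ (s + 2) * M) \<le> w * cop * (real (card P) * 4 ^ (s + 3) * (c * c') * real (n + 1))"
    by (simp add: power_add mult_ac)
  also have "\<dots> \<le> w * cop * real n ^ 2"
    using wpos by (intro mult_left_mono n2) (auto simp: cop_def)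
  finally have "4 * tips * (real n ^ (s + 2) * M) \<le> w * cop * real n ^ 2" .
  moreover have "w * (3 * \<epsilon>) * (real n ^ (s + 2) * M) \<le> 4 * tips * (real n ^ (s + 2) * M)"
    using tips_ge Mpos by (intro mult_right_mono) auto
  ultimately have "(w * real n ^ 2) * (3 * (\<epsilon> * real n ^ s * M)) \<le> (w * real n ^ 2) * cop"
    by (simp add: power_add power2_eq_square mult_ac)
  then have "3 * (\<epsilon> * real n ^ s * M) \<le> cop"
    using wpos npos by (simp add: mult_le_cancel_left_pos)
  moreover have "0 \<le> cop" by (simp add: cop_def)
  ultimately have "\<epsilon> * real n ^ s * M \<le> cop" by linarith
  also have "cop \<le> real (card (induced_copies_in P rel (Pow {1..n}) (cube_order n) F))"
    unfolding cop_def using finF card_induced_copies_in_mono[of F1 F] by (simp add: F1_def)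
  finally show ?thesis by (simp add: M_def)
qed

theorem theorem1p7:
  shows "\<exists>K::real. K > 0 \<and> (\<exists>c :: nat \<Rightarrow> nat \<Rightarrow> real.
    (\<forall>t\<ge>1. \<forall>d\<ge>1. c t d > 0) \<and>
    (\<forall>(P :: nat set) (r :: nat rel) (C :: real) (d :: nat).
       finite P \<and> card P \<ge> 2 \<and> partial_order_on P r \<and> d \<ge> 1 \<and>
       (\<forall>n\<ge>1. real (ex_star n d P r) \<le> C * real n ^ (d - 1)) \<longrightarrow>
       (\<forall>t\<ge>1. \<forall>\<epsilon>>0. \<exists>N. \<forall>n\<ge>N. \<forall>F \<subseteq> Pow {1..n}.
          real (card F) \<ge> (real t + K * sqrt (real d) * C + \<epsilon>) * real (n choose (n div 2)) \<longrightarrow>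
          real (card (induced_copies_in P r (Pow {1..n}) (cube_order n) F))
            \<ge> c t d * \<epsilon> * real n powi \<lfloor>real t / (K * sqrt (real d))\<rfloor> * real (n choose (n div 2)))))"
proof (intro exI[of _ "40 :: real"] exI[of _ "\<lambda>_ _. 1 :: real"] conjI allI impI)
  fix P :: "nat set" and rel :: "nat rel" and C :: real and d t :: nat and \<epsilon> :: real
  assume A: "finite P \<and> card P \<ge> 2 \<and> partial_order_on P rel \<and> d \<ge> 1 \<and>
       (\<forall>n\<ge>1. real (ex_star n d P rel) \<le> C * real n ^ (d - 1))"
    and "t \<ge> 1" "\<epsilon> > 0"
  then have P: "finite P" "card P \<ge> 2" and d: "d \<ge> 1"
    and ex: "\<forall>n\<ge>1. real (ex_star n d P rel) \<le> C * real n ^ (d - 1)" by auto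
  have C: "C \<ge> 1" using ex_star_bound_ge_1[OF P ex] .
  define s where "s = nat \<lfloor>real t / (40 * sqrt (real d))\<rfloor>"
  have s: "\<lfloor>real t / (40 * sqrt (real d))\<rfloor> = int s" by (simp add: s_def)
  have "real s \<le> real t / (40 * sqrt (real d))" by (simp add: s_def)
  then have ts: "40 * sqrt (real d) * real s \<le> real t" using d by (simp add: field_simps)
  obtain r where r0: "1 \<le> r" "r \<le> d" "d \<le> r\<^sup>2" "real r \<le> 2 * sqrt (real d)"
    using obtain_ceiling_sqrt[OF d] .
  obtain c where c: "c > 0" "\<And>a k. s + 2 \<le> a \<Longrightarrow> 2 * a \<le> k \<Longrightarrow> real (a + 1) ^ d * real k ^ (s + 2) \<le> c * real (k choose a)"
    using power_mult_power_le_const_binomial[of "s + 2" d] by blast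
  obtain c' where c': "c' > 0" "\<And>a k. 2 * a \<le> k \<Longrightarrow> real (a + 1) ^ d \<le> c' * real (k choose a)"
    using power_mult_power_le_const_binomial[of 0 d] by auto
  obtain N0 where N0: "\<And>n k. n \<ge> N0 \<Longrightarrow> central_size n k \<Longrightarrow> real (32 * d) * \<bar>2 * real k - real n\<bar> \<le> real n"
    using large_binomial_near_middle[of "32 * d"] d unfolding central_size_def by auto
  define L where "L = real (card P) * 4 ^ (s + 3) * (c * c')"
  have L: "L \<ge> 0" using c(1) c'(1) by (simp add: L_def)
  show "\<exists>N. \<forall>n\<ge>N. \<forall>F \<subseteq> Pow {1..n}.
          real (card F) \<ge> (real t + 40 * sqrt (real d) * C + \<epsilon>) * real (n choose (n div 2)) \<longrightarrow>
          real (card (induced_copies_in P rel (Pow {1..n}) (cube_order n) F))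
            \<ge> 1 * \<epsilon> * real n powi \<lfloor>real t / (40 * sqrt (real d))\<rfloor> * real (n choose (n div 2))"
  \<comment> \<open>\<open>N0\<close> centres the relevant sizes, \<open>16 d\<close> makes the blocks nonempty, and \<open>2 L\<close> absorbs all constants.\<close>
  proof (intro exI[of _ "max N0 (max (16 * d) (nat \<lceil>2 * L\<rceil>))"] allI impI)
    fix n F
    assume large: "n \<ge> max N0 (max (16 * d) (nat \<lceil>2 * L\<rceil>))" and F: "F \<subseteq> Pow {1..n}"
      and big: "real (card F) \<ge> (real t + 40 * sqrt (real d) * C + \<epsilon>) * real (n choose (n div 2))"
    define m where "m = n div (16 * d)"
    have m: "m \<ge> 1" using large d by (simp add: m_def Suc_le_eq div_greater_zero_iff)
    have "16 * d * m \<le> n" unfolding m_def by (rule times_div_less_eq_dividend)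
    then have n16: "16 * (d * m) \<le> n" by (simp add: mult.assoc)
    have "n < 16 * d * (m + 1)" using d unfolding m_def
      by (metis Suc_eq_plus1 dividend_less_times_div less_le_trans mult_Suc_right add.commute
          mult_pos_pos zero_less_numeral zero_less_one)
    also have "\<dots> \<le> 16 * d * (2 * m)" using m by (intro mult_le_mono2) simp
    finally have "real n \<le> real (16 * d * (2 * m))" by (simp only: of_nat_le_iff)
    then have n32: "real n \<le> real (32 * d) * real m" by simp
    interpret random_grid n m d r
    proof
      fix k assume "central_size n k"
      then have "real (32 * d) * \<bar>2 * real k - real n\<bar> \<le> real (32 * d) * real m"
        using N0[of n k] large n32 by simp
      then show "\<bar>2 * real k - real n\<bar> \<le> real m" using d by simp
    qed (use d m r0 n16 in auto)
    have nL: "real n \<ge> 2 * L" using large by linarith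
    have n1: "real n \<ge> 1" using large d by linarith
    have "L * real (n + 1) \<le> L * (2 * real n)" using L n1 by (intro mult_left_mono) auto
    also have "\<dots> \<le> real n * real n" using mult_right_mono[OF nL, of "real n"] by (simp add: mult_ac)
    finally have n2: "L * real (n + 1) \<le> real n ^ 2" by (simp add: power2_eq_square)
    show "real (card (induced_copies_in P rel (Pow {1..n}) (cube_order n) F))
            \<ge> 1 * \<epsilon> * real n powi \<lfloor>real t / (40 * sqrt (real d))\<rfloor> * real (n choose (n div 2))"
      using card_copies_ge[OF F P _ C r0(4) ts big c c' n2[unfolded L_def]] ex m
      by (simp add: s)
  qed
qed simp_all

end
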